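(* Consider the plant $\dot x\in A(x,u)$, $y=g(x,u)$ with constraint set $K$, and suppose it satisfies the properties "Steady-state behavior", "Compatibility", "Maximal dissipative coupling", "Distinguishability" and "Compactness" stated in the context. Let $r\in Y$ and let $(x^\star,u^\star)\in\mathrm{dom}(\mathcal A_r)$ be an $h$-detectable equilibrium of the closed loop $$\dot x\in A(x,z),\qquad \dot z\in r-g(x,z)-N_K(z).$$ Then for all initial data $(x_0,z_0)\in C\times K$ the corresponding (generalized) solution $(x,z)\in\mathcal C([0,+\infty),X\times Y)$ of the closed loop satisfies $$(x(t),z(t))\to(x^\star,u^\star)\quad\text{in }X\times Y,\qquad t\to+\infty.$$ Moreover, for any $r\in Y$ and for all initial data $(x_0,z_0)\in C\times K$, the corresponding closed-loop solution satisfies $z(t)\in K$ for all $t\ge0$.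
   Context: All vector spaces are real. $X$ and $U=Y$ are Hilbert spaces, $C\subset X$ is nonempty, closed and convex, and $K\subset Y$ is nonempty, closed and convex with nonempty interior. A multivalued map $M:E\rightrightarrows F$ assigns to each $x\in E$ a possibly empty set $M(x)\subset F$; $\mathrm{dom}(M)=\{x: M(x)\ne\emptyset\}$, $\mathrm{ran}(M)=\bigcup_x M(x)$. For a Hilbert space $H$, $M:H\rightrightarrows H$ is maximal dissipative if $\langle f_1-f_2,x_1-x_2\rangle_H\le 0$ for all $x_i\in\mathrm{dom}(M)$, $f_i\in M(x_i)$, and there exists $\lambda>0$ with $\mathrm{ran}(\lambda\,\mathrm{id}-M)=H$. Plant: $\dot x\in A(x,u)$, $y=g(x,u)$, where $A:X\times U\rightrightarrows X$ is multivalued and $g:\mathrm{dom}(g)\subset X\times U\to Y$ is single-valued. A steady-state pair is $(x^\star,u^\star)\in C\times K$ with $0\in A(x^\star,u^\star)$. Standing assumptions. - Steady-state behavior: for each $u\in K$ there is a unique $x\in C$ with $0\in A(x,u)$; for each $x\in C$ there is at most one $u\in K$ with $0\in A(x,u)$. - Compatibility: $\mathrm{dom}(A)\subset\mathrm{dom}(g)$ and $U=Y$. - Maximal dissipative coupling: $\mathcal A:X\times Y\rightrightarrows X\times Y$, $\mathcal A(x,u)=A(x,u)\times\{-g(x,u)\}$, is maximal dissipative and $\overline{\mathrm{dom}(\mathcal A)}=C\times Y$. - Distinguishability: if $(x^\star,u^\star)$, $(x^\dagger,u^\dagger)$ are steady-state pairs with $\langle u^\star-u^\dagger,g(x^\star,u^\star)-g(x^\dagger,u^\dagger)\rangle_Y=0$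 (this quantity is $h(x^\star,u^\star;x^\dagger,u^\dagger)$ for the function $h$ below), then $x^\star=x^\dagger$. - Compactness: $Y$ is finite-dimensional, and there is $\lambda>0$ such that for all bounded $F\subset X$, $V\subset U$ the set of all $x$ satisfying $f\in\lambda x-A(x,u)$ for some $f\in F$, $u\in V$ is relatively compact in $X$. A function on $[0,+\infty)$ with values in a Hilbert space is absolutely continuous if on each $[0,T]$ it is a constant plus the indefinite integral of an $L^1$ function. Given $u:[0,+\infty)\to U$ absolutely continuous, a strong solution of $\dot x\in A(x,u)$ with input $u$ is an absolutely continuous $x:[0,+\infty)\to X$ with $x(t)\in\mathrm{dom}(A(\cdot,u(t)))$ for all $t\ge0$ and $\dot x(t)\in A(x(t),u(t))$ a.e. (Constant functions given by a steady-state pair form such a solution.) For strong solutions $x_1,x_2$ with inputs $u_1,u_2$, define a.e. on $(0,+\infty)$ $$h(x_1,u_1;x_2,u_2)=\langle u_1-u_2,g(x_1,u_1)-g(x_2,u_2)\rangle_Y-\tfrac12\tfrac{d}{dt}\|x_1-x_2\|_X^2 .$$ Normal cone: $N_K(z)=\{w\in Y:\langle w,z-y\rangle_Y\ge0\ \forall y\in K\}$ for $z\in K$, $N_K(z)=\emptyset$ otherwise. Closed-loop operator: $\mathcal A_r(x,z)=A(x,z)\times(r-g(x,z)-N_K(z))$ on $\mathrm{dom}(\mathcal A_r)=\{(x,z)\in C\times K: x\in\mathrm{dom}(A(\cdot,z))\}$. A strong solution of the closed loop is an absolutely continuous function with values in $\mathrm{dom}(\mathcal A_r)$ satisfying $(\dot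 x,\dot z)\in\mathcal A_r(x,z)$ a.e. (then $x$ is a strong solution of the plant with input $z$); a generalized solution is a function that on each $[0,T]$ is the uniform limit of strong solutions. For each $(x_0,z_0)\in C\times K$ there is exactly one generalized solution starting there. An equilibrium of the closed loop is a point $(x^\star,u^\star)$ that is a constant solution, equivalently $0\in\mathcal A_r(x^\star,u^\star)$. An equilibrium $(x^\star,u^\star)$ of the closed loop is $h$-detectable if, given any strong solution $(x,z)$ of the closed loop, $h(x,z;x^\star,u^\star)=0$ a.e. implies $x(t)\to x^\star$ in $X$ as $t\to+\infty$. *)

theory Defs
  imports "HOL-Analysis.Analysis"
begin

text \<open>Hilbert spaces are types of sort \<open>{real_inner, complete_space}\<close>; they need not be
  separable. A multivalued map is a function into sets, the value \<open>{}\<close> being allowed. The input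
  space and the output space \<open>U = Y\<close> are the same type.\<close>

definition mdom :: "('e \<Rightarrow> 'f set) \<Rightarrow> 'e set" where
  "mdom M = {x. M x \<noteq> {}}"

definition mran :: "('e \<Rightarrow> 'f set) \<Rightarrow> 'f set" where
  "mran M = (\<Union>x. M x)"

definition maximal_dissipative :: "('h::real_inner \<Rightarrow> 'h set) \<Rightarrow> bool" where
  "maximal_dissipative M \<longleftrightarrow>
     (\<forall>x1\<in>mdom M. \<forall>x2\<in>mdom M. \<forall>f1\<in>M x1. \<forall>f2\<in>M x2. (f1 - f2) \<bullet> (x1 - x2) \<le> 0) \<and>
     (\<exists>l>0. mran (\<lambda>x. {l *\<^sub>R x - f | f. f \<in> M x}) = UNIV)"


subsection \<open>The plant\<close>

text \<open>The partial map \<open>g\<close> is a total function together with its domain \<open>Dg\<close>; its values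
  outside \<open>Dg\<close> carry no meaning.\<close>

definition coupling ::
  "('x::real_inner \<times> 'y::real_inner \<Rightarrow> 'x set) \<Rightarrow> ('x \<times> 'y \<Rightarrow> 'y) \<Rightarrow> 'x \<times> 'y \<Rightarrow> ('x \<times> 'y) set" where
  "coupling A g p = A p \<times> {- g p}"

definition steady_state_pair ::
  "('x::real_inner \<times> 'y::real_inner \<Rightarrow> 'x set) \<Rightarrow> 'x set \<Rightarrow> 'y set \<Rightarrow> 'x \<Rightarrow> 'y \<Rightarrow> bool" where
  "steady_state_pair A C K x u \<longleftrightarrow> x \<in> C \<and> u \<in> K \<and> 0 \<in> A (x, u)"

definition steady_state_behavior ::
  "('x::real_inner \<times> 'y::real_inner \<Rightarrow> 'x set) \<Rightarrow> 'x set \<Rightarrow> 'y set \<Rightarrow> bool" where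
  "steady_state_behavior A C K \<longleftrightarrow>
     (\<forall>u\<in>K. \<exists>!x. x \<in> C \<and> 0 \<in> A (x, u)) \<and>
     (\<forall>x\<in>C. \<forall>u\<in>K. \<forall>v\<in>K. 0 \<in> A (x, u) \<and> 0 \<in> A (x, v) \<longrightarrow> u = v)"

definition compatibility ::
  "('x::real_inner \<times> 'y::real_inner \<Rightarrow> 'x set) \<Rightarrow> ('x \<times> 'y) set \<Rightarrow> bool" where
  "compatibility A Dg \<longleftrightarrow> mdom A \<subseteq> Dg"

definition maximal_dissipative_coupling ::
  "('x::real_inner \<times> 'y::real_inner \<Rightarrow> 'x set) \<Rightarrow> ('x \<times> 'y \<Rightarrow> 'y) \<Rightarrow> 'x set \<Rightarrow> bool" where
  "maximal_dissipative_coupling A g C \<longleftrightarrow>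
     maximal_dissipative (coupling A g) \<and> closure (mdom (coupling A g)) = C \<times> UNIV"

definition distinguishability ::
  "('x::real_inner \<times> 'y::real_inner \<Rightarrow> 'x set) \<Rightarrow> ('x \<times> 'y \<Rightarrow> 'y) \<Rightarrow> 'x set \<Rightarrow> 'y set \<Rightarrow> bool" where
  "distinguishability A g C K \<longleftrightarrow>
     (\<forall>x u x' u'. steady_state_pair A C K x u \<and> steady_state_pair A C K x' u' \<and>
        (u - u') \<bullet> (g (x, u) - g (x', u')) = 0 \<longrightarrow> x = x')"

definition compactness ::
  "('x::real_inner \<times> 'y::real_inner \<Rightarrow> 'x set) \<Rightarrow> bool" where
  "compactness A \<longleftrightarrow>
     (\<exists>B::'y set. finite B \<and> span B = UNIV) \<and>
     (\<exists>l>0. \<forall>F V. bounded F \<and> bounded V \<longrightarrow>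
        compact (closure {x. \<exists>f\<in>F. \<exists>u\<in>V. f \<in> {l *\<^sub>R x - a | a. a \<in> A (x, u)}}))"


subsection \<open>Absolutely continuous functions and solutions\<close>

text \<open>The library's Bochner integral requires a second countable range. \<open>L1_on\<close> states Bochner
  integrability without it: strong measurability and integrable norm. For such functions the gauge
  integral \<open>has_integral\<close> exists and agrees with the Bochner integral, in every Banach space.\<close>

definition L1_on :: "real set \<Rightarrow> (real \<Rightarrow> 'h::real_normed_vector) \<Rightarrow> bool" where
  "L1_on S f \<longleftrightarrow>
     (\<exists>s. (\<forall>i::nat. simple_function (lebesgue_on S) (s i)) \<and>
          (AE t in lebesgue_on S. (\<lambda>i. s i t) \<longlonglongrightarrow> f t)) \<and>
     integrable (lebesgue_on S) (\<lambda>t. norm (f t))"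

definition abs_continuous :: "(real \<Rightarrow> 'h::real_normed_vector) \<Rightarrow> bool" where
  "abs_continuous x \<longleftrightarrow>
     (\<forall>T\<ge>0. \<exists>c f. L1_on {0..T} f \<and> (\<forall>t\<in>{0..T}. (f has_integral (x t - c)) {0..t}))"

text \<open>Solutions live on \<open>[0, +\<infinity>)\<close>; the values at negative times are ignored.\<close>

definition strong_solution :: "('h::real_normed_vector \<Rightarrow> 'h set) \<Rightarrow> (real \<Rightarrow> 'h) \<Rightarrow> bool" where
  "strong_solution M w \<longleftrightarrow>
     abs_continuous w \<and> (\<forall>t\<ge>0. w t \<in> mdom M) \<and>
     (AE t in lebesgue. t > 0 \<longrightarrow> (\<exists>d\<in>M (w t). (w has_vector_derivative d) (at t)))"

definition generalized_solution :: "('h::real_normed_vector \<Rightarrow> 'h set) \<Rightarrow> (real \<Rightarrow> 'h) \<Rightarrow> bool" where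
  "generalized_solution M w \<longleftrightarrow>
     (\<forall>T\<ge>0. \<exists>v. (\<forall>n::nat. strong_solution M (v n)) \<and> uniform_limit {0..T} v w sequentially)"

definition equilibrium :: "('h::real_normed_vector \<Rightarrow> 'h set) \<Rightarrow> 'h \<Rightarrow> bool" where
  "equilibrium M p \<longleftrightarrow> strong_solution M (\<lambda>_. p)"

lemma abs_continuous_const: "abs_continuous (\<lambda>_. p)"
  unfolding abs_continuous_def L1_on_def
proof (intro allI impI exI conjI ballI)
  fix T :: real and i :: nat
  show "simple_function (lebesgue_on {0..T}) ((\<lambda>_ _. 0) i)" by simp
qed (auto intro: has_integral_0)

lemma equilibrium_iff: "equilibrium M p \<longleftrightarrow> 0 \<in> M p"
proof
  assume "0 \<in> M p"
  then show "equilibrium M p"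
    unfolding equilibrium_def strong_solution_def mdom_def
    by (auto intro!: abs_continuous_const AE_I2 bexI[of _ 0])
next
  assume "equilibrium M p"
  then have "AE t in lebesgue. t > 0 \<longrightarrow> (\<exists>d\<in>M p. ((\<lambda>_. p) has_vector_derivative d) (at t))"
    unfolding equilibrium_def strong_solution_def by blast
  then have *: "AE t::real in lebesgue. t > 0 \<longrightarrow> 0 \<in> M p"
    by eventually_elim (metis has_vector_derivative_const vector_derivative_at)
  show "0 \<in> M p"
  proof (rule ccontr)
    assume "0 \<notin> M p"
    from * have "AE t::real in lebesgue. t \<notin> {0<..<1}"
      by eventually_elim (use \<open>0 \<notin> M p\<close> in auto)
    then have "emeasure lebesgue {0<..<1::real} = 0"
      by (subst (asm) AE_iff_measurable[where N = "{0<..<1::real}"]) auto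
    then show False by simp
  qed
qed


subsection \<open>The closed loop\<close>

definition normal_cone :: "'y::real_inner set \<Rightarrow> 'y \<Rightarrow> 'y set" where
  "normal_cone K z = (if z \<in> K then {w. \<forall>y\<in>K. w \<bullet> (z - y) \<ge> 0} else {})"

definition closed_loop ::
  "('x::real_inner \<times> 'y::real_inner \<Rightarrow> 'x set) \<Rightarrow> ('x \<times> 'y \<Rightarrow> 'y) \<Rightarrow> 'x set \<Rightarrow> 'y set \<Rightarrow> 'y
     \<Rightarrow> 'x \<times> 'y \<Rightarrow> ('x \<times> 'y) set" where
  "closed_loop A g C K r p =
     (if p \<in> C \<times> K then A p \<times> {r - g p - w | w. w \<in> normal_cone K (snd p)} else {})"

lemma mdom_closed_loop: "mdom (closed_loop A g C K r) = {(x, z). x \<in> C \<and> z \<in> K \<and> A (x, z) \<noteq> {}}"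
proof -
  have "0 \<in> normal_cone K z" if "z \<in> K" for z using that by (simp add: normal_cone_def)
  then show ?thesis unfolding mdom_def closed_loop_def by (auto; metis empty_iff)
qed

definition h_fun ::
  "('x::real_inner \<times> 'y::real_inner \<Rightarrow> 'y) \<Rightarrow> (real \<Rightarrow> 'x) \<Rightarrow> (real \<Rightarrow> 'y) \<Rightarrow> (real \<Rightarrow> 'x) \<Rightarrow> (real \<Rightarrow> 'y)
     \<Rightarrow> real \<Rightarrow> real" where
  "h_fun g x1 u1 x2 u2 t =
     (u1 t - u2 t) \<bullet> (g (x1 t, u1 t) - g (x2 t, u2 t))
       - 1 / 2 * deriv (\<lambda>s. (norm (x1 s - x2 s))\<^sup>2) t"

definition h_detectable ::
  "('x::real_inner \<times> 'y::real_inner \<Rightarrow> 'x set) \<Rightarrow> ('x \<times> 'y \<Rightarrow> 'y) \<Rightarrow> 'x set \<Rightarrow> 'y set \<Rightarrow> 'y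
     \<Rightarrow> 'x \<Rightarrow> 'y \<Rightarrow> bool" where
  "h_detectable A g C K r xs us \<longleftrightarrow>
     (\<forall>x z. strong_solution (closed_loop A g C K r) (\<lambda>t. (x t, z t)) \<longrightarrow>
        (AE t in lebesgue. t > 0 \<longrightarrow> h_fun g x z (\<lambda>_. xs) (\<lambda>_. us) t = 0) \<longrightarrow>
        (x \<longlongrightarrow> xs) at_top)"

end

theory Submission
  imports Defs
begin

text \<open>
  The closed-loop operator \<open>M\<close> is dissipative, so any two strong solutions approach each other
  monotonically (\<open>dissipative_contraction\<close>). Two reductions follow. A generalized solution is a
  uniform limit on \<open>[0, +\<infinity>)\<close> of strong solutions (\<open>generalized_solution_uniform_limit\<close>), so it is
  enough to show that a strong solution \<open>v\<close> converges to the equilibrium. And \<open>v\<close>, compared with its own shifts,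
  is Lipschitz from some time on (\<open>trajectory_eventually_lipschitz\<close>); with the
  compactness assumption its orbit is then precompact (\<open>precompact_orbit\<close>).

  The rest is LaSalle's principle with the Lyapunov function \<open>norm (v t - (xs, us))\<close>. Along a solution
  \<open>W\<close> in the \<open>\<omega>\<close>-limit set this distance is constant, which forces \<open>h = 0\<close> (\<open>limit_solution_h_zero\<close>);
  detectability makes the state component converge, and a second passage to the limit together with the
  uniqueness of the steady input settles the integrator component (\<open>strong_solution_converges\<close>).

  Detectability speaks about strong solutions, so the limit \<open>W\<close> of shifts of \<open>v\<close> has to be recognised as
  one (\<open>lipschitz_limit_strong_solution\<close>). This takes two ingredients. The limit is Lipschitz, and
  Lipschitz functions into a Hilbert space are differentiable almost everywhere and are integrals of their
  derivatives (\<open>lipschitz_differentiable_ae\<close>, \<open>lipschitz_abs_continuous\<close>); the proof is by \<open>L\<^sup>2\<close>-convergence of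
  dyadic difference quotients and Lebesgue points. And the derivative has to lie in \<open>M (W t)\<close>; for
  this a convexified closedness of the graph of \<open>M\<close> suffices (\<open>closed_loop_hull_closed\<close>), which the
  closed loop inherits from the maximality of the coupling because an interior point of \<open>K\<close> bounds the normal vectors.
  Compactness of bounded sets of velocities enters only through nested bounded closed convex sets
  (\<open>nested_convex_Inter_nonempty\<close>).
\<close>

section \<open>Convex sets and integral means in Hilbert space\<close>

text \<open>This is weak compactness of bounded closed convex sets, in terms of intersections. By the
parallelogram law, points whose norms nearly minimise the norm over the
shrinking sets form a Cauchy sequence, because the minimal norms increase to a finite limit.\<close>

lemma nested_convex_Inter_nonempty:
  fixes S :: "nat \<Rightarrow> 'h::{real_inner, complete_space} set"
  assumes ne: "\<And>n. S n \<noteq> {}" and cl: "\<And>n. closed (S n)" and cv: "\<And>n. convex (S n)"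
    and dec: "\<And>n. S (Suc n) \<subseteq> S n" and bd: "bounded (S 0)"
  shows "(\<Inter>n. S n) \<noteq> {}"
proof -
  have mono: "S m \<subseteq> S n" if "n \<le> m" for m n
    using dec that by (metis lift_Suc_antimono_le)
  obtain B where B: "\<And>x. x \<in> S 0 \<Longrightarrow> norm x \<le> B"
    using bd bounded_iff by blast
  define \<delta> where "\<delta> n = (INF x\<in>S n. norm x)" for n
  have bb: "bdd_below (norm ` S n)" for n
    by (rule bdd_belowI[of _ 0]) auto
  have \<delta>le: "\<delta> n \<le> norm x" if "x \<in> S n" for x n
    unfolding \<delta>_def using bb that by (rule cINF_lower)
  have \<delta>ge: "0 \<le> \<delta> n" for n
    unfolding \<delta>_def using ne by (intro cINF_greatest) auto
  have \<delta>B: "\<delta> n \<le> B" for n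
  proof -
    obtain x where "x \<in> S n" using ne by blast
    then show ?thesis using \<delta>le[of x n] B[of x] mono[of 0 n] by force
  qed
  have \<delta>mono: "\<delta> n \<le> \<delta> m" if "n \<le> m" for m n
    unfolding \<delta>_def[of m] using ne mono[OF that] \<delta>le by (intro cINF_greatest) auto
  have "\<exists>x\<in>S n. norm x \<le> \<delta> n + inverse (Suc n)" for n
  proof -
    have "\<delta> n < \<delta> n + inverse (Suc n)" by simp
    then show ?thesis unfolding \<delta>_def by (subst (asm) cINF_less_iff[OF ne bb]) (auto intro: less_imp_le)
  qed
  then obtain c where c: "\<And>n. c n \<in> S n" "\<And>n. norm (c n) \<le> \<delta> n + inverse (Suc n)"
    by metis
  have "incseq \<delta>" using \<delta>mono by (simp add: incseq_def)
  then obtain d where d: "\<delta> \<longlonglongrightarrow> d" using incseq_convergent[of \<delta> B] \<delta>B by blast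
  have \<delta>d: "\<delta> n \<le> d" for n using incseq_le[OF \<open>incseq \<delta>\<close> d] .
  define \<eta> where "\<eta> n = (2 * (d + inverse (Suc n))\<^sup>2 + 2 * (d + inverse (Suc n))\<^sup>2) - 4 * (\<delta> n)\<^sup>2" for n
  have "(\<lambda>n. inverse (real (Suc n))) \<longlonglongrightarrow> 0" by (rule LIMSEQ_inverse_real_of_nat)
  then have "\<eta> \<longlonglongrightarrow> (2 * (d + 0)\<^sup>2 + 2 * (d + 0)\<^sup>2) - 4 * d\<^sup>2"
    unfolding \<eta>_def by (intro tendsto_intros d)
  then have \<eta>0: "\<eta> \<longlonglongrightarrow> 0" by simp
  have key: "(norm (c n - c m))\<^sup>2 \<le> \<eta> n" if "n \<le> m" for n m
  proof -
    have "(1/2) *\<^sub>R c n + (1/2) *\<^sub>R c m \<in> S n"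
      using convexD[OF cv c(1)[of n], of "c m" "1/2" "1/2"] mono[OF that] c(1)[of m] by auto
    from \<delta>le[OF this] have "2 * \<delta> n \<le> norm (c n + c m)"
      by (simp flip: scaleR_right_distrib)
    then have 1: "4 * (\<delta> n)\<^sup>2 \<le> (norm (c n + c m))\<^sup>2"
      using power_mono[of "2 * \<delta> n" _ 2] \<delta>ge[of n] by (simp add: power_mult_distrib)
    have par: "(norm (c n - c m))\<^sup>2 = 2 * (norm (c n))\<^sup>2 + 2 * (norm (c m))\<^sup>2 - (norm (c n + c m))\<^sup>2"
      by (simp add: power2_norm_eq_inner algebra_simps inner_commute)
    have "norm (c n) \<le> d + inverse (Suc n)" using c(2)[of n] \<delta>d[of n] by linarith
    moreover have "norm (c m) \<le> d + inverse (Suc n)"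
    proof -
      have "inverse (real (Suc m)) \<le> inverse (real (Suc n))" using that by (simp add: le_imp_inverse_le)
      then show ?thesis using c(2)[of m] \<delta>d[of m] by linarith
    qed
    ultimately have "(norm (c n))\<^sup>2 \<le> (d + inverse (Suc n))\<^sup>2" "(norm (c m))\<^sup>2 \<le> (d + inverse (Suc n))\<^sup>2"
      by (simp_all add: power_mono)
    then show ?thesis unfolding par \<eta>_def using 1 by linarith
  qed
  have "Cauchy c"
  proof (rule metric_CauchyI)
    fix e :: real assume "e > 0"
    then have "eventually (\<lambda>n. \<eta> n < (e/2)\<^sup>2) sequentially"
      using order_tendstoD(2)[OF \<eta>0] by simp
    then obtain N where N: "\<eta> N < (e/2)\<^sup>2" by (auto simp: eventually_sequentially)
    have "norm (c N - c m) < e/2" if "N \<le> m" for m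
      using key[OF that] N \<open>e > 0\<close> power2_less_imp_less[of "norm (c N - c m)" "e/2"] by simp
    then have "dist (c m) (c n) < e" if "N \<le> m" "N \<le> n" for m n
      using that dist_triangle_half_r[of "c N" "c m" e "c n"] by (simp add: dist_norm)
    then show "\<exists>M. \<forall>m\<ge>M. \<forall>n\<ge>M. dist (c m) (c n) < e" by blast
  qed
  then obtain l where l: "c \<longlonglongrightarrow> l" using Cauchy_convergent convergent_def by blast
  have "l \<in> S n" for n
  proof (rule closed_sequentially[OF cl, of "\<lambda>k. c (k + n)"])
    show "c (k + n) \<in> S n" for k using c(1)[of "k+n"] mono[of n "k+n"] by auto
    show "(\<lambda>k. c (k + n)) \<longlonglongrightarrow> l" using l by (rule LIMSEQ_ignore_initial_segment)
  qed
  then show ?thesis by blast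
qed

text \<open>The near-minimisers of the distance are nested closed convex sets, so the preceding lemma yields
a minimiser; the variational inequality is then the usual one.\<close>

lemma Hilbert_nearest_point:
  fixes S :: "'h::{real_inner, complete_space} set"
  assumes "S \<noteq> {}" "closed S" "convex S"
  obtains s where "s \<in> S" "\<And>y. y \<in> S \<Longrightarrow> (a - s) \<bullet> (y - s) \<le> 0"
proof -
  define \<delta> where "\<delta> = (INF x\<in>S. dist a x)"
  have bb: "bdd_below (dist a ` S)" by (rule bdd_belowI[of _ 0]) auto
  define T where "T n = S \<inter> cball a (\<delta> + inverse (Suc n))" for n :: nat
  have "(\<Inter>n. T n) \<noteq> {}"
  proof (rule nested_convex_Inter_nonempty)
    fix n
    have "\<delta> < \<delta> + inverse (Suc n)" by simp
    then show "T n \<noteq> {}" 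
      unfolding T_def \<delta>_def by (subst (asm) cINF_less_iff[OF assms(1) bb]) (auto intro: less_imp_le)
    show "closed (T n)" "convex (T n)" unfolding T_def using assms by (auto intro: convex_Int)
    have "inverse (real (Suc (Suc n))) \<le> inverse (real (Suc n))" by simp
    then have "cball a (\<delta> + inverse (Suc (Suc n))) \<subseteq> cball a (\<delta> + inverse (Suc n))"
      by (intro subset_cball) linarith
    then show "T (Suc n) \<subseteq> T n" unfolding T_def by blast
    show "bounded (T 0)" unfolding T_def by (meson bounded_Int bounded_cball)
  qed
  then obtain s where s: "\<And>n. s \<in> T n" by blast
  have "dist a s \<le> \<delta>"
  proof (rule LIMSEQ_le_const)
    have "(\<lambda>n. \<delta> + inverse (real (Suc n))) \<longlonglongrightarrow> \<delta> + 0"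
      by (intro tendsto_intros LIMSEQ_inverse_real_of_nat)
    then show "(\<lambda>n. \<delta> + inverse (real (Suc n))) \<longlonglongrightarrow> \<delta>" by simp
    show "\<exists>N. \<forall>n\<ge>N. dist a s \<le> \<delta> + inverse (real (Suc n))" using s by (auto simp: T_def)
  qed
  then have "\<forall>z\<in>S. dist a s \<le> dist a z"
    unfolding \<delta>_def using bb by (meson cINF_lower order_trans)
  moreover have "s \<in> S" using s by (auto simp: T_def)
  ultimately show thesis using that any_closest_point_dot[OF assms(3,2)] by metis
qed

lemma has_integral_inner:
  assumes "(f has_integral I) S" shows "((\<lambda>t. f t \<bullet> e) has_integral (I \<bullet> e)) S"
  using has_integral_linear[OF assms bounded_linear_inner_left[of e]] by (simp add: o_def)

text \<open>The sort \<open>{real_inner, complete_space}\<close> is not a subsort of \<open>banach\<close>, so the norm estimates for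
vector-valued gauge integrals do not apply to it. Testing with \<open>e = I\<close> replaces them and asks
just for the integrals of the scalar functions \<open>f t \<bullet> e\<close>.\<close>

lemma weak_has_integral_norm_le:
  fixes f :: "'n::euclidean_space \<Rightarrow> 'h::real_inner"
  assumes f: "\<And>e. ((\<lambda>t. f t \<bullet> e) has_integral I \<bullet> e) S" and g: "(g has_integral J) S"
    and le: "\<And>t. t \<in> S \<Longrightarrow> norm (f t) \<le> g t"
  shows "norm I \<le> J"
proof -
  have "I \<bullet> I \<le> J * norm I"
  proof (rule has_integral_le[OF f has_integral_mult_left[OF g]])
    fix t assume "t \<in> S"
    have "f t \<bullet> I \<le> norm (f t) * norm I" by (rule norm_cauchy_schwarz)
    also have "\<dots> \<le> g t * norm I" using le[OF \<open>t \<in> S\<close>] by (simp add: mult_right_mono)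
    finally show "f t \<bullet> I \<le> g t * norm I" .
  qed
  then have *: "norm I * norm I \<le> J * norm I" by (simp add: power2_norm_eq_inner flip: power2_eq_square)
  show ?thesis
  proof (cases "I = 0")
    case False then show ?thesis using * by simp
  next
    case True
    have "0 \<le> J" using has_integral_nonneg[OF g] le norm_ge_zero order_trans by blast
    then show ?thesis using True by simp
  qed
qed

text \<open>Otherwise the nearest point of \<open>S\<close> to the mean would separate the mean from all values of \<open>f\<close>.\<close>

lemma has_integral_mean_in_convex:
  fixes f :: "real \<Rightarrow> 'h::{real_inner, complete_space}"
  assumes f: "(f has_integral I) {a..b}" and ab: "a < b"
    and N: "negligible N" and fS: "\<And>t. t \<in> {a..b} - N \<Longrightarrow> f t \<in> S"
    and S: "closed S" "convex S"
  shows "I /\<^sub>R (b - a) \<in> S"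
proof (rule ccontr)
  assume notin: "I /\<^sub>R (b - a) \<notin> S"
  have "\<not> {a..b} \<subseteq> N"
  proof
    assume "{a..b} \<subseteq> N"
    then have "negligible {a..b}" using N negligible_subset by blast
    then show False using ab negligible_interval(1)[of a b] by simp
  qed
  then have "S \<noteq> {}" using fS by blast
  then obtain s where s: "s \<in> S" "\<And>y. y \<in> S \<Longrightarrow> (I /\<^sub>R (b - a) - s) \<bullet> (y - s) \<le> 0"
    using Hilbert_nearest_point S by metis
  define c where "c = I /\<^sub>R (b - a) - s"
  define g where "g t = (if t \<in> N then s else f t)" for t
  have "(g has_integral I) {a..b}"
    by (rule has_integral_spike[OF N _ f]) (simp add: g_def)
  from has_integral_inner[OF this, of c] 
  have "((\<lambda>t. g t \<bullet> c) has_integral I \<bullet> c) {a..b}" .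
  moreover have "((\<lambda>t. s \<bullet> c) has_integral (b - a) * (s \<bullet> c)) {a..b}"
    using has_integral_const_real[of "s \<bullet> c" a b] ab by simp
  ultimately have "I \<bullet> c \<le> (b - a) * (s \<bullet> c)"
  proof (rule has_integral_le)
    fix t assume t: "t \<in> {a..b}"
    show "g t \<bullet> c \<le> s \<bullet> c"
      using s(2)[OF fS, of t] t unfolding c_def[symmetric]
      by (auto simp: g_def inner_diff_right inner_commute)
  qed
  moreover have "I = (b - a) *\<^sub>R (c + s)" using ab by (simp add: c_def)
  ultimately have "(b - a) * (c \<bullet> c) \<le> 0" by (simp add: inner_left_distrib algebra_simps)
  then have "c \<bullet> c \<le> 0" using ab by (simp add: mult_le_0_iff)
  then have "c = 0" by (metis inner_ge_zero inner_eq_zero_iff order_antisym)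
  then show False using notin s(1) by (simp add: c_def)
qed

section \<open>The fundamental theorem with a null exceptional set\<close>

text \<open>An exceptional null set is harmless as soon as the increments of \<open>w\<close> are dominated by the integral of
some \<open>g\<close>: redefine \<open>g\<close> as \<open>0\<close> on \<open>N\<close>; Henstock's lemma then makes the integrals of \<open>g\<close> over the intervals
tagged in \<open>N\<close> add up to something small. Both Lipschitz functions (\<open>g\<close> constant) and absolutely
continuous ones fall under this lemma.\<close>

lemma fundamental_theorem_dominated:
  fixes w f :: "real \<Rightarrow> 'h::real_normed_vector" and g :: "real \<Rightarrow> real"
  assumes ab: "a \<le> b" and N: "negligible N"
    and g: "g integrable_on {a..b}"
    and dom: "\<And>s t. a \<le> s \<Longrightarrow> s \<le> t \<Longrightarrow> t \<le> b \<Longrightarrow> norm (w t - w s) \<le> integral {s..t} g"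
    and der: "\<And>t. t \<in> {a..b} - N \<Longrightarrow> (w has_vector_derivative f t) (at t within {a..b})"
  shows "(f has_integral (w b - w a)) {a..b}"
proof -
  define F where "F t = (if t \<in> N then 0 else f t)" for t
  define G where "G t = (if t \<in> N then 0 else g t)" for t
  have Gint: "G integrable_on {a..b}"
    by (rule integrable_spike[OF g N]) (simp add: G_def)
  have Gg: "integral {s..t} G = integral {s..t} g" for s t
    by (rule integral_spike[OF N]) (simp add: G_def)
  have "(F has_integral (w b - w a)) (cbox a b)"
    unfolding has_integral
  proof (intro allI impI)
    fix e :: real assume e: "e > 0"
    define \<epsilon> where "\<epsilon> = e / (2 * (b - a + 1))"
    have \<epsilon>: "\<epsilon> > 0" using e ab by (simp add: \<epsilon>_def)
    have "\<forall>x. \<exists>d>0. x \<in> {a..b} - N \<longrightarrow>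
         (\<forall>y\<in>{a..b}. norm (y-x) < d \<longrightarrow> norm (w y - w x - (y-x) *\<^sub>R F x) \<le> \<epsilon> * norm (y-x))"
    proof
      fix x
      show "\<exists>d>0. x \<in> {a..b} - N \<longrightarrow>
         (\<forall>y\<in>{a..b}. norm (y-x) < d \<longrightarrow> norm (w y - w x - (y-x) *\<^sub>R F x) \<le> \<epsilon> * norm (y-x))"
      proof (cases "x \<in> {a..b} - N")
        case True
        then show ?thesis
          using der[OF True, unfolded has_vector_derivative_def has_derivative_within_alt] \<epsilon>
          by (auto simp: F_def)
      next
        case False
        then show ?thesis by (intro exI[of _ 1]) auto
      qed
    qed
    then obtain d where d: "\<And>x. 0 < d x"
      "\<And>x y. \<lbrakk>x \<in> {a..b} - N; y \<in> {a..b}; norm (y-x) < d x\<rbrakk>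
              \<Longrightarrow> norm (w y - w x - (y-x) *\<^sub>R F x) \<le> \<epsilon> * norm (y-x)"
      by metis
    obtain \<gamma> where \<gamma>: "gauge \<gamma>"
      "\<And>p. \<lbrakk>p tagged_partial_division_of (cbox a b); \<gamma> fine p\<rbrakk> \<Longrightarrow>
             (\<Sum>(x,k)\<in>p. norm(measure lborel k *\<^sub>R G x - integral k G)) < e / 2"
      using Henstock_lemma[of G a b "e/2"] Gint e by auto
    have "gauge (\<lambda>x. ball x (d x) \<inter> \<gamma> x)"
      using \<gamma>(1) gauge_ball_dependent[of d] d(1) by (intro gauge_Int) auto
    moreover have "norm ((\<Sum>(x, k)\<in>p. measure lborel k *\<^sub>R F x) - (w b - w a)) < e"
      if p: "p tagged_division_of cbox a b" and fine: "(\<lambda>x. ball x (d x) \<inter> \<gamma> x) fine p" for p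
    proof -
      have part: "p tagged_partial_division_of cbox a b"
        using p tagged_division_of_def by blast
      have fine1: "(\<lambda>x. ball x (d x)) fine p" and fine2: "\<gamma> fine p"
        using fine by (auto simp: fine_def)
      have sumF: "w b - w a = (\<Sum>(x,K)\<in>p. w(Sup K) - w(Inf K))"
        and suml: "b - a = (\<Sum>(x,K)\<in>p. Sup K - Inf K)"
        using additive_tagged_division_1[OF ab, of p w] additive_tagged_division_1[OF ab, of p "\<lambda>x. x"] p
        by simp_all
      have tm: "norm (measure lborel K *\<^sub>R F x - (w(Sup K) - w(Inf K)))
          \<le> \<epsilon> * (Sup K - Inf K) + norm (measure lborel K *\<^sub>R G x - integral K G)" if pK: "(x,K) \<in> p" for x K
      proof -
        obtain u v where K: "K = cbox u v" and xK: "x \<in> K" and kab: "K \<subseteq> cbox a b"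
          using tagged_division_ofD(2,3,4)[OF p pK] by blast
        have uv: "u \<le> v" using xK K by auto
        have uvK: "u \<in> K" "v \<in> K" using uv K by auto
        have uab: "a \<le> u" "v \<le> b" "x \<in> {a..b}" using kab uvK xK by auto
        have cS: "Sup K = v" "Inf K = u" "measure lborel K = v - u" using uv K by auto
        show ?thesis
        proof (cases "x \<in> N")
          case True
          have "norm (w v - w u) \<le> integral {u..v} g" using dom uab uv by auto
          also have "\<dots> = integral K G" using K Gg by simp
          also have "\<dots> \<le> norm (measure lborel K *\<^sub>R G x - integral K G)" using True by (simp add: G_def)
          finally have "norm (w v - w u) \<le> norm (measure lborel K *\<^sub>R G x - integral K G)" .
          moreover have "0 \<le> \<epsilon> * (v - u)" using \<epsilon> uv by simp
          ultimately show ?thesis using True cS norm_minus_commute[of "w u" "w v"]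
            by (simp add: F_def)
        next
          case False
          have ball: "\<forall>y\<in>K. y \<in> ball x (d x)" using fineD[OF fine1 pK] by auto
          have "norm ((v - u) *\<^sub>R F x - (w v - w u)) =
              norm (w u - w x - (u - x) *\<^sub>R F x - (w v - w x - (v - x) *\<^sub>R F x))"
            by (auto simp: algebra_simps)
          also have "\<dots> \<le> norm (w u - w x - (u - x) *\<^sub>R F x) + norm (w v - w x - (v - x) *\<^sub>R F x)"
            by (rule norm_triangle_ineq4)
          also have "\<dots> \<le> \<epsilon> * norm (u - x) + \<epsilon> * norm (v - x)"
            using ball uvK uab uv False
            by (intro add_mono d(2)) (simp_all add: dist_real_def abs_minus_commute)
          also have "\<dots> = \<epsilon> * (v - u)" using xK K by (auto simp: algebra_simps)
          finally show ?thesis unfolding cS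
            using norm_ge_zero[of "(v - u) *\<^sub>R G x - integral K G"] by linarith
        qed
      qed
      have "norm ((\<Sum>(x, k)\<in>p. measure lborel k *\<^sub>R F x) - (w b - w a))
          = norm (\<Sum>(x,K)\<in>p. measure lborel K *\<^sub>R F x - (w(Sup K) - w(Inf K)))"
        unfolding sumF by (simp add: split_def sum_subtractf)
      also have "\<dots> \<le> (\<Sum>(x,K)\<in>p. \<epsilon> * (Sup K - Inf K) + norm (measure lborel K *\<^sub>R G x - integral K G))"
        by (rule sum_norm_le) (use tm in \<open>simp add: split_def split_paired_all del: real_norm_def\<close>)
      also have "\<dots> = \<epsilon> * (b - a) + (\<Sum>(x,K)\<in>p. norm (measure lborel K *\<^sub>R G x - integral K G))"
        unfolding suml by (simp add: split_def sum.distrib sum_distrib_left)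
      also have "\<dots> < \<epsilon> * (b - a) + e / 2"
        using \<gamma>(2)[OF part fine2] by simp
      also have "\<dots> \<le> e"
      proof -
        have "\<epsilon> * (b - a) \<le> e/2" using e ab by (simp add: \<epsilon>_def field_simps)
        then show ?thesis by simp
      qed
      finally show ?thesis .
    qed
    ultimately show "\<exists>\<gamma>. gauge \<gamma> \<and>
            (\<forall>\<D>. \<D> tagged_division_of cbox a b \<and> \<gamma> fine \<D> \<longrightarrow>
                 norm ((\<Sum>(x, k)\<in>\<D>. measure lborel k *\<^sub>R F x) - (w b - w a)) < e)"
      by (intro exI[of _ "\<lambda>x. ball x (d x) \<inter> \<gamma> x"] conjI allI impI) (assumption | elim conjE)+
  qed
  then have *: "(F has_integral (w b - w a)) {a..b}" by (simp only: cbox_interval)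
  show ?thesis by (rule has_integral_spike[OF N _ *]) (simp add: F_def)
qed

section \<open>Lipschitz functions into a Hilbert space\<close>

text \<open>The slope of \<open>w\<close> over the dyadic interval of length \<open>2 ^ - n\<close> that contains \<open>t\<close>. As functions of \<open>t\<close>
these form a martingale, and they are simple functions, so that their limit is strongly measurable
whatever the Hilbert space.\<close>

definition dyadic_slope :: "(real \<Rightarrow> 'h::real_normed_vector) \<Rightarrow> nat \<Rightarrow> real \<Rightarrow> 'h" where
  "dyadic_slope w n t =
     2 ^ n *\<^sub>R (w (of_int (\<lfloor>2 ^ n * t\<rfloor> + 1) / 2 ^ n) - w (of_int \<lfloor>2 ^ n * t\<rfloor> / 2 ^ n))"

lemma dyadic_slope_cell:
  assumes "of_int j / 2 ^ n \<le> t" "t < of_int (j + 1) / 2 ^ n"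
  shows "dyadic_slope w n t = 2 ^ n *\<^sub>R (w (of_int (j + 1) / 2 ^ n) - w (of_int j / 2 ^ n))"
proof -
  have "\<lfloor>2 ^ n * t\<rfloor> = j"
    using assms by (intro floor_unique) (simp_all add: field_simps)
  then show ?thesis by (simp add: dyadic_slope_def)
qed

lemma dyadic_slope_integral_cell:
  fixes w :: "real \<Rightarrow> 'h::real_inner"
  shows "((\<lambda>t. dyadic_slope w n t \<bullet> e) has_integral
    (w (of_int (j + 1) / 2 ^ n) - w (of_int j / 2 ^ n)) \<bullet> e) {of_int j / 2 ^ n..of_int (j + 1) / 2 ^ n}"
proof -
  let ?a = "real_of_int j / 2 ^ n" and ?b = "real_of_int (j + 1) / 2 ^ n"
  let ?c = "(2 ^ n *\<^sub>R (w ?b - w ?a)) \<bullet> e"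
  have "?a \<le> ?b" by (simp add: divide_right_mono)
  then have "((\<lambda>t. ?c) has_integral ((?b - ?a) *\<^sub>R ?c)) {?a..?b}"
    using has_integral_const_real[of ?c ?a ?b] by simp
  moreover have "(?b - ?a) *\<^sub>R ?c = (w ?b - w ?a) \<bullet> e"
    by (simp add: diff_divide_distrib[symmetric])
  ultimately have "((\<lambda>t. ?c) has_integral ((w ?b - w ?a) \<bullet> e)) {?a..?b}" by (simp only:)
  then show ?thesis
    by (rule has_integral_spike_finite[of "{?b}", rotated 2]) (auto simp: dyadic_slope_cell)
qed

lemma dyadic_slope_integral:
  fixes w :: "real \<Rightarrow> 'h::real_inner"
  assumes "i \<le> j"
  shows "((\<lambda>t. dyadic_slope w n t \<bullet> e) has_integral
    (w (of_int j / 2 ^ n) - w (of_int i / 2 ^ n)) \<bullet> e) {of_int i / 2 ^ n..of_int j / 2 ^ n}"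
  using assms
proof (induction j rule: int_ge_induct)
  case base
  then show ?case by (simp add: has_integral_refl)
next
  case (step j)
  have "real_of_int i / 2 ^ n \<le> of_int j / 2 ^ n" "real_of_int j / 2 ^ n \<le> of_int (j + 1) / 2 ^ n"
    using step(1) by (simp_all add: divide_right_mono)
  from has_integral_combine[OF this step(2) dyadic_slope_integral_cell[of w n e j]]
  show ?case by (simp add: inner_diff_left)
qed

lemma has_integral_dyadic_partition:
  fixes F :: "real \<Rightarrow> real"
  assumes "\<And>j. ((F has_integral s j) {real j / 2 ^ m..real (Suc j) / 2 ^ m})"
  shows "(F has_integral (\<Sum>j<k. s j)) {0..real k / 2 ^ m}"
proof (induction k)
  case (Suc k)
  have "0 \<le> real k / 2 ^ m" "real k / 2 ^ m \<le> real (Suc k) / 2 ^ m"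
    by (simp_all add: divide_right_mono)
  from has_integral_combine[OF this Suc assms[of k]]
  show ?case by simp
qed (simp add: has_integral_refl)

lemma dyadic_slope_inner_integral_cell:
  fixes w :: "real \<Rightarrow> 'h::real_inner"
  assumes "m \<le> n"
  shows "((\<lambda>t. dyadic_slope w n t \<bullet> dyadic_slope w m t) has_integral
    2 ^ m * (norm (w (real (Suc j) / 2 ^ m) - w (real j / 2 ^ m)))\<^sup>2) {real j / 2 ^ m..real (Suc j) / 2 ^ m}"
proof -
  let ?a = "real j / 2 ^ m" and ?b = "real (Suc j) / 2 ^ m"
  define d where "d = 2 ^ m *\<^sub>R (w ?b - w ?a)"
  define i where "i = int j * 2 ^ (n - m)"
  define k where "k = int (Suc j) * 2 ^ (n - m)"
  have two: "(2::real) ^ n = 2 ^ m * 2 ^ (n - m)" using assms by (simp flip: power_add)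
  have ab: "?a = of_int i / 2 ^ n" "?b = of_int k / 2 ^ n" by (simp_all add: i_def k_def two)
  have "i \<le> k" by (simp add: i_def k_def)
  from dyadic_slope_integral[OF this, of w n d]
  have "((\<lambda>t. dyadic_slope w n t \<bullet> d) has_integral (w ?b - w ?a) \<bullet> d) {?a..?b}" by (simp only: ab)
  moreover have "(w ?b - w ?a) \<bullet> d = 2 ^ m * (norm (w ?b - w ?a))\<^sup>2"
    by (simp add: d_def power2_norm_eq_inner)
  ultimately have "((\<lambda>t. dyadic_slope w n t \<bullet> d) has_integral 2 ^ m * (norm (w ?b - w ?a))\<^sup>2) {?a..?b}"
    by simp
  moreover have "dyadic_slope w m t = d" if "t \<in> {?a..?b} - {?b}" for t
    using that dyadic_slope_cell[of "int j" m t w] by (simp add: d_def add.commute)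
  ultimately show ?thesis
    by (elim has_integral_spike_finite[of "{?b}", rotated 2]) simp_all
qed

text \<open>Martingale orthogonality: on a cell of level \<open>m\<close> the coarse slope is constant and equal to the mean of
the fine slope. Hence the energies \<open>\<integral> (norm (dyadic_slope w m t))\<^sup>2\<close> increase with \<open>m\<close>, and their
differences control the \<open>L\<^sup>2\<close> distances of the slopes.\<close>

lemma dyadic_slope_inner_integral:
  fixes w :: "real \<Rightarrow> 'h::real_inner"
  assumes "m \<le> n"
  shows "((\<lambda>t. dyadic_slope w n t \<bullet> dyadic_slope w m t) has_integral
    integral {0..1} (\<lambda>t. (norm (dyadic_slope w m t))\<^sup>2)) {0..1}"
proof -
  let ?S = "\<Sum>j<2 ^ m. 2 ^ m * (norm (w (real (Suc j) / 2 ^ m) - w (real j / 2 ^ m)))\<^sup>2"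
  have 1: "((\<lambda>t. dyadic_slope w k t \<bullet> dyadic_slope w m t) has_integral ?S) {0..1}" if "m \<le> k" for k
    using has_integral_dyadic_partition[OF dyadic_slope_inner_integral_cell[OF that, of w], of "2 ^ m"]
    by simp
  have "((\<lambda>t. (norm (dyadic_slope w m t))\<^sup>2) has_integral ?S) {0..1}"
    using 1[of m] by (simp add: power2_norm_eq_inner)
  then show ?thesis using 1[OF assms] by (simp add: integral_unique)
qed

lemma dyadic_slope_diff_integral:
  fixes w :: "real \<Rightarrow> 'h::real_inner"
  assumes "m \<le> n"
  shows "((\<lambda>t. (norm (dyadic_slope w n t - dyadic_slope w m t))\<^sup>2) has_integral
    (integral {0..1} (\<lambda>t. (norm (dyadic_slope w n t))\<^sup>2) - integral {0..1} (\<lambda>t. (norm (dyadic_slope w m t))\<^sup>2))) {0..1}"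
proof -
  have *: "(\<lambda>t. (norm (dyadic_slope w n t - dyadic_slope w m t))\<^sup>2) =
     (\<lambda>t. (dyadic_slope w n t \<bullet> dyadic_slope w n t - 2 * (dyadic_slope w n t \<bullet> dyadic_slope w m t))
        + dyadic_slope w m t \<bullet> dyadic_slope w m t)"
    by (simp add: power2_norm_eq_inner inner_diff_left inner_diff_right inner_commute algebra_simps)
  show ?thesis unfolding *
    by (rule has_integral_eq_rhs[OF has_integral_add[OF has_integral_diff[OF dyadic_slope_inner_integral
         has_integral_mult_right[OF dyadic_slope_inner_integral]] dyadic_slope_inner_integral]])
       (use assms in auto)
qed

lemma dyadic_slope_bound:
  assumes "\<And>s t. norm (w t - w s) \<le> L * \<bar>t - s\<bar>"
  shows "norm (dyadic_slope w n t) \<le> L"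
proof -
  let ?j = "\<lfloor>2 ^ n * t\<rfloor>"
  have "norm (w (of_int (?j + 1) / 2 ^ n) - w (of_int ?j / 2 ^ n)) \<le> L * \<bar>of_int (?j + 1) / 2 ^ n - of_int ?j / 2 ^ n\<bar>"
    by (rule assms)
  also have "\<dots> = L / 2 ^ n" by (simp add: field_simps abs_if)
  finally have "norm (w (of_int (?j + 1) / 2 ^ n) - w (of_int ?j / 2 ^ n)) \<le> L / 2 ^ n" .
  then show ?thesis unfolding dyadic_slope_def norm_scaleR
    by (subst (asm) pos_le_divide_eq) (simp_all add: mult.commute)
qed

lemma borel_measurable_dyadic_slope:
  fixes \<phi> :: "'h::real_normed_vector \<Rightarrow> 'b::topological_space"
  shows "(\<lambda>t. \<phi> (dyadic_slope w n t)) \<in> borel_measurable borel"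
  unfolding dyadic_slope_def
proof (rule measurable_compose[where N = "count_space UNIV" and f = "\<lambda>t. \<lfloor>2 ^ n * t\<rfloor>"])
  show "(\<lambda>t::real. \<lfloor>2 ^ n * t\<rfloor>) \<in> borel \<rightarrow>\<^sub>M count_space UNIV" by measurable
qed simp

lemma borel_bounded_integrable_on:
  fixes F :: "real \<Rightarrow> real"
  assumes "F \<in> borel_measurable borel" "\<And>t. \<bar>F t\<bar> \<le> B"
  shows "F integrable_on {a..b}"
proof (rule measurable_bounded_by_integrable_imp_integrable[where g = "\<lambda>_. B"])
  have "F \<in> borel_measurable lborel" using assms(1) by simp
  then have "F \<in> borel_measurable lebesgue" by (rule measurable_completion)
  then show "F \<in> borel_measurable (lebesgue_on {a..b})"
    by (rule measurable_restrict_space1)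
qed (use assms(2) in auto)

lemma integrable_dyadic_slope:
  fixes \<phi> :: "'h::real_normed_vector \<Rightarrow> real"
  assumes "\<And>t. \<bar>\<phi> (dyadic_slope w n t)\<bar> \<le> B"
  shows "(\<lambda>t. \<phi> (dyadic_slope w n t)) integrable_on {a..b}"
  using borel_measurable_dyadic_slope assms by (rule borel_bounded_integrable_on)

lemma Cauchy_from_increment_sums:
  fixes x :: "nat \<Rightarrow> 'a::metric_space"
  assumes "convergent (\<lambda>n. \<Sum>k<n. dist (x (Suc k)) (x k))"
  shows "Cauchy x"
proof -
  let ?s = "\<lambda>n. \<Sum>k<n. dist (x (Suc k)) (x k)"
  have le: "dist (x (m + k)) (x m) \<le> ?s (m + k) - ?s m" for m k
  proof (induction k)
    case (Suc k)
    then show ?case using dist_triangle[of "x (Suc (m+k))" "x m" "x (m+k)"] by simp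
  qed simp
  have C: "Cauchy ?s" using assms convergent_Cauchy by blast
  show ?thesis
  proof (rule metric_CauchyI)
    fix e :: real assume "e > 0"
    then obtain M where M: "\<And>m n. m \<ge> M \<Longrightarrow> n \<ge> M \<Longrightarrow> dist (?s m) (?s n) < e/2"
      using C unfolding Cauchy_def by (meson half_gt_zero)
    have "dist (x n) (x M) < e/2" if "n \<ge> M" for n
      using le[of M "n - M"] M[of n M] that abs_ge_self[of "?s n - ?s M"]
      unfolding dist_real_def[of "?s n"] by (simp del: abs_ge_self)
    then have "dist (x m) (x n) < e" if "m \<ge> M" "n \<ge> M" for m n
      using that dist_triangle_half_l by blast
    then show "\<exists>M. \<forall>m\<ge>M. \<forall>n\<ge>M. dist (x m) (x n) < e" by blast
  qed
qed

lemma nonneg_series_summable_ae: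
  fixes G :: "nat \<Rightarrow> real \<Rightarrow> real"
  assumes meas: "\<And>k. G k \<in> borel_measurable borel" and nn: "\<And>k t. 0 \<le> G k t"
    and int: "\<And>k. G k integrable_on {a..b}" and le: "\<And>k. integral {a..b} (G k) \<le> B k"
    and B: "summable B"
  obtains N where "negligible N" "\<And>t. t \<in> {a..b} - N \<Longrightarrow> summable (\<lambda>k. G k t)"
proof -
  define F where "F k t = indicator {a..b} t * G k t" for k t
  have [measurable]: "F k \<in> borel_measurable borel" for k
    unfolding F_def using meas[of k] by measurable
  have Fm: "(\<lambda>t. ennreal (F k t)) \<in> borel_measurable lborel" for k by measurable
  have F0: "0 \<le> F k t" for k t using nn by (simp add: F_def)
  have Fi: "(\<integral>\<^sup>+t. ennreal (F k t) \<partial>lborel) = ennreal (integral {a..b} (G k))" for k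
    unfolding F_def using nn_integral_has_integral_lebesgue[OF nn integrable_integral[OF int]] by simp
  have B0: "0 \<le> B k" for k
    using le[of k] integral_nonneg[OF int nn, of k] by simp
  have "(\<integral>\<^sup>+t. (\<Sum>k. ennreal (F k t)) \<partial>lborel) = (\<Sum>k. ennreal (integral {a..b} (G k)))"
    by (subst nn_integral_suminf[OF Fm]) (simp add: Fi)
  also have "\<dots> \<le> (\<Sum>k. ennreal (B k))"
    by (intro suminf_le ennreal_leI le summableI)
  also have "\<dots> = ennreal (\<Sum>k. B k)" using B0 B by (rule suminf_ennreal2)
  finally have "(\<integral>\<^sup>+t. (\<Sum>k. ennreal (F k t)) \<partial>lborel) \<noteq> \<infinity>"
    by (metis ennreal_less_top infinity_ennreal_def leD)
  then have "AE t in lborel. (\<Sum>k. ennreal (F k t)) \<noteq> \<infinity>"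
    by (intro nn_integral_noteq_infinite) measurable
  then obtain N where N: "\<And>t. t \<notin> N \<Longrightarrow> (\<Sum>k. ennreal (F k t)) \<noteq> \<infinity>" "N \<in> null_sets lborel"
    by (elim AE_E3) auto
  have "negligible N" using N(2) by (simp add: negligible_iff_null_sets null_sets_completionI)
  moreover have "summable (\<lambda>k. G k t)" if "t \<in> {a..b} - N" for t
  proof -
    have "summable (\<lambda>k. F k t)"
      using N(1)[of t] that by (intro summable_suminf_not_top F0) auto
    then show ?thesis using that by (simp add: F_def)
  qed
  ultimately show thesis using that by blast
qed

text \<open>The energies increase and are bounded by \<open>L ^ 2\<close>, so the slopes are Cauchy in the mean square sense; a
rapidly converging subsequence has summable increments almost everywhere.\<close>

lemma dyadic_slopes_converge_ae:
  fixes w :: "real \<Rightarrow> 'h::{real_inner, complete_space}"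
  assumes lip: "\<And>s t. norm (w t - w s) \<le> L * \<bar>t - s\<bar>"
  obtains r f N where "strict_mono r" "negligible N"
    "\<And>t. t \<in> {0..1} - N \<Longrightarrow> (\<lambda>k. dyadic_slope w (r k) t) \<longlonglongrightarrow> f t"
proof -
  define E where "E n = integral {0..1} (\<lambda>t. (norm (dyadic_slope w n t))\<^sup>2)" for n
  note db = dyadic_slope_bound[OF lip]
  have L0: "0 \<le> L" using db[of 0 0] norm_ge_zero order_trans by blast
  have sqint: "(\<lambda>t. (norm (dyadic_slope w n t))\<^sup>2) integrable_on {0..1}" for n
    by (rule integrable_dyadic_slope[where B = "L\<^sup>2" and \<phi> = "\<lambda>v. (norm v)\<^sup>2"]) (simp add: db power_mono)
  have "incseq E"
  proof (rule incseq_SucI)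
    fix n
    have "0 \<le> E (Suc n) - E n" unfolding E_def
      by (rule has_integral_nonneg[OF dyadic_slope_diff_integral]) auto
    then show "E n \<le> E (Suc n)" by simp
  qed
  moreover have "E n \<le> L\<^sup>2" for n
  proof -
    have "E n \<le> integral {0..1} (\<lambda>t::real. L\<^sup>2)" unfolding E_def
      by (rule integral_le[OF sqint]) (auto simp: db power_mono)
    then show ?thesis by simp
  qed
  ultimately have "Cauchy E" using incseq_convergent[of E "L\<^sup>2"] convergentI convergent_Cauchy by metis
  \<comment> \<open>squared distances below \<open>4 ^ - k\<close> give summable distances, by \<open>2 x \<le> 2 ^ - k + 2 ^ k * x\<^sup>2\<close>\<close>
  then have "\<exists>M. \<forall>m\<ge>M. \<forall>n\<ge>M. dist (E m) (E n) < (1/4) ^ k" for k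
    unfolding Cauchy_def by (meson zero_less_power zero_less_divide_1_iff zero_less_numeral)
  then obtain M where M: "\<And>k m n. m \<ge> M k \<Longrightarrow> n \<ge> M k \<Longrightarrow> dist (E m) (E n) < (1/4) ^ k"
    by metis
  define r where "r = rec_nat (M 0) (\<lambda>k v. max (Suc v) (M (Suc k)))"
  have r0: "r 0 = M 0" and rS: "r (Suc k) = max (Suc (r k)) (M (Suc k))" for k
    by (simp_all add: r_def)
  have rmono: "strict_mono r" by (rule strict_mono_Suc_iff[THEN iffD2]) (simp add: rS less_max_iff_disj)
  have rM: "M k \<le> r k" for k by (cases k) (simp_all add: r0 rS)
  define G where "G k t = dist (dyadic_slope w (r (Suc k)) t) (dyadic_slope w (r k) t)" for k t
  have rle: "r k \<le> r (Suc k)" for k by (simp add: rS)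
  have Gsq: "((\<lambda>t. (G k t)\<^sup>2) has_integral (E (r (Suc k)) - E (r k))) {0..1}" for k
    using dyadic_slope_diff_integral[OF rle, of w k] by (simp add: G_def dist_norm E_def)
  have Gb: "G k t \<le> 2 * L" for k t
    using norm_triangle_ineq4[of "dyadic_slope w (r (Suc k)) t" "dyadic_slope w (r k) t"]
      db[of "r (Suc k)" t] db[of "r k" t] by (simp add: G_def dist_norm)
  have Gmeas: "G k \<in> borel_measurable borel" for k
  proof -
    let ?slope = "\<lambda>n (j::int). 2 ^ n *\<^sub>R (w (of_int (j + 1) / 2 ^ n) - w (of_int j / 2 ^ n))"
    have "(\<lambda>t. dist (?slope (r (Suc k)) \<lfloor>2 ^ r (Suc k) * t\<rfloor>) (dyadic_slope w (r k) t)) \<in> borel_measurable borel"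
    proof (rule measurable_compose_countable[where g = "\<lambda>t::real. \<lfloor>2 ^ r (Suc k) * t\<rfloor>"])
      show "(\<lambda>t::real. \<lfloor>2 ^ r (Suc k) * t\<rfloor>) \<in> borel \<rightarrow>\<^sub>M count_space UNIV" by measurable
    qed (rule borel_measurable_dyadic_slope)
    then show ?thesis by (simp add: G_def[abs_def] dyadic_slope_def)
  qed
  have Gint: "G k integrable_on {0..1}" for k
    using Gmeas Gb by (intro borel_bounded_integrable_on[where B = "2 * L"]) (simp_all add: G_def)
  have G1: "integral {0..1} (G k) \<le> (1/2) ^ k" for k
  proof -
    have "integral {0..1} (G k) \<le> ((1/2) ^ k + 2 ^ k * (E (r (Suc k)) - E (r k))) / 2"
    proof (rule has_integral_le[OF integrable_integral[OF Gint]
            has_integral_divide[OF has_integral_add[OF _ has_integral_mult_right[OF Gsq]]]])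
      show "((\<lambda>t. (1/2) ^ k) has_integral (1/2 :: real) ^ k) {0..1::real}"
        using has_integral_const_real[of "(1/2::real) ^ k" 0 1] by simp
      fix t :: real
      have "0 \<le> (1/2) ^ k * (1 - 2 ^ k * G k t)\<^sup>2" by simp
      also have "(1/2) ^ k * (1 - 2 ^ k * G k t)\<^sup>2 = (1/2) ^ k + 2 ^ k * (G k t)\<^sup>2 - 2 * G k t"
        by (simp add: power2_eq_square algebra_simps power_divide)
      finally show "G k t \<le> ((1/2) ^ k + 2 ^ k * (G k t)\<^sup>2) / 2" by simp
    qed
    also have "E (r (Suc k)) - E (r k) \<le> (1/4) ^ k"
      using M[OF order_trans[OF rM rle] rM, of k] by (simp add: dist_real_def)
    also have "2 ^ k * (1/4::real) ^ k = (1/2) ^ k" by (simp flip: power_mult_distrib)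
    finally show ?thesis by simp
  qed
  obtain N where N: "negligible N" "\<And>t. t \<in> {0..1} - N \<Longrightarrow> summable (\<lambda>k. G k t)"
  proof (rule nonneg_series_summable_ae[of G 0 1 "\<lambda>k. (1/2) ^ k"])
    show "0 \<le> G k t" for k t by (simp add: G_def)
  qed (use Gmeas Gint G1 in auto)
  define f where "f t = lim (\<lambda>k. dyadic_slope w (r k) t)" for t
  have "(\<lambda>k. dyadic_slope w (r k) t) \<longlonglongrightarrow> f t" if "t \<in> {0..1} - N" for t
  proof -
    have "Cauchy (\<lambda>k. dyadic_slope w (r k) t)"
      using N(2)[OF that] by (intro Cauchy_from_increment_sums) (simp add: G_def summable_iff_convergent)
    then show ?thesis unfolding f_def using Cauchy_convergent convergent_LIMSEQ_iff by blast
  qed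
  then show thesis using that rmono N(1) by blast
qed

text \<open>The error term accounts for rounding \<open>a\<close> and \<open>b\<close> down to multiples of \<open>2 ^ - n\<close>: two boundary
increments of \<open>w t - t c\<close> and one boundary piece of the integral.\<close>

lemma dyadic_slope_increment:
  fixes w :: "real \<Rightarrow> 'h::real_inner"
  assumes lip: "\<And>s t. norm (w t - w s) \<le> L * \<bar>t - s\<bar>" and ab: "a \<le> b"
  shows "norm (w b - w a - (b - a) *\<^sub>R c)
    \<le> integral {a..b} (\<lambda>t. norm (dyadic_slope w n t - c)) + 3 * (L + norm c) / 2 ^ n"
proof -
  define i where "i = \<lfloor>2 ^ n * a\<rfloor>"
  define j where "j = \<lfloor>2 ^ n * b\<rfloor>"
  define p where "p = of_int i / (2::real) ^ n"
  define q where "q = of_int j / (2::real) ^ n"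
  define \<Lambda> where "\<Lambda> = L + norm c"
  define u where "u t = w t - t *\<^sub>R c" for t
  let ?D = "\<lambda>t. norm (dyadic_slope w n t - c)"
  note db = dyadic_slope_bound[OF lip]
  have fl: "of_int \<lfloor>2 ^ n * t\<rfloor> / 2 ^ n \<le> t" "t - of_int \<lfloor>2 ^ n * t\<rfloor> / 2 ^ n \<le> 1 / 2 ^ n" for t :: real
  proof -
    show "of_int \<lfloor>2 ^ n * t\<rfloor> / 2 ^ n \<le> t" by (simp add: pos_divide_le_eq mult.commute)
    have "2 ^ n * t - of_int \<lfloor>2 ^ n * t\<rfloor> \<le> 1" by linarith
    then have "(2 ^ n * t - of_int \<lfloor>2 ^ n * t\<rfloor>) / 2 ^ n \<le> 1 / 2 ^ n" by (simp add: divide_right_mono)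
    then show "t - of_int \<lfloor>2 ^ n * t\<rfloor> / 2 ^ n \<le> 1 / 2 ^ n" by (simp add: diff_divide_distrib)
  qed
  have pa: "p \<le> a" "a - p \<le> 1 / 2 ^ n" and qb: "q \<le> b" "b - q \<le> 1 / 2 ^ n"
    using fl[of a] fl[of b] by (auto simp: p_def q_def i_def j_def)
  have "i \<le> j" unfolding i_def j_def using ab by (intro floor_mono) simp
  then have pq: "p \<le> q" unfolding p_def q_def by (simp add: divide_right_mono)
  have L0: "0 \<le> L" using db[of 0 0] norm_ge_zero order_trans by blast
  then have \<Lambda>0: "0 \<le> \<Lambda>" by (simp add: \<Lambda>_def)
  have ulip: "norm (u t - u s) \<le> \<Lambda> * \<bar>t - s\<bar>" for s t
  proof -
    have "u t - u s = (w t - w s) - (t - s) *\<^sub>R c" by (simp add: u_def algebra_simps)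
    then have "norm (u t - u s) \<le> norm (w t - w s) + norm ((t - s) *\<^sub>R c)"
      by (metis norm_triangle_ineq4)
    also have "\<dots> \<le> L * \<bar>t - s\<bar> + \<bar>t - s\<bar> * norm c" using lip[of t s] by simp
    finally show ?thesis by (simp add: \<Lambda>_def algebra_simps)
  qed
  have Db: "?D t \<le> \<Lambda>" for t
    unfolding \<Lambda>_def using norm_triangle_ineq4[of "dyadic_slope w n t" c] db[of n t] by linarith
  have Dint: "?D integrable_on {x..y}" for x y
    by (rule integrable_dyadic_slope[of "\<lambda>v. norm (v - c)" w n \<Lambda>]) (simp add: Db)
  have "norm (u q - u p) \<le> integral {p..q} ?D"
  proof (rule weak_has_integral_norm_le[OF _ integrable_integral[OF Dint]])
    fix e
    have 1: "((\<lambda>t. dyadic_slope w n t \<bullet> e) has_integral (w q - w p) \<bullet> e) {p..q}"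
      using dyadic_slope_integral[OF \<open>i \<le> j\<close>, of w n e] by (simp add: p_def q_def)
    have 2: "((\<lambda>t. c \<bullet> e) has_integral ((q - p) * (c \<bullet> e))) {p..q}"
      using has_integral_const_real[of "c \<bullet> e" p q] pq by simp
    show "((\<lambda>t. (dyadic_slope w n t - c) \<bullet> e) has_integral (u q - u p) \<bullet> e) {p..q}"
      using has_integral_diff[OF 1 2] by (simp add: u_def inner_diff_left algebra_simps)
  qed simp
  also have "\<dots> \<le> integral {p..b} ?D"
    by (rule integral_subset_le) (use qb Dint in auto)
  also have "\<dots> = integral {p..a} ?D + integral {a..b} ?D"
    using Henstock_Kurzweil_Integration.integral_combine[OF pa(1) ab Dint] by simp
  also have "integral {p..a} ?D \<le> integral {p..a} (\<lambda>_. \<Lambda>)"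
    by (rule integral_le[OF Dint]) (auto simp: Db)
  also have "\<dots> = (a - p) * \<Lambda>" using pa by simp
  also have "\<dots> \<le> \<Lambda> / 2 ^ n" using mult_right_mono[OF pa(2) \<Lambda>0] by simp
  finally have 1: "norm (u q - u p) \<le> \<Lambda> / 2 ^ n + integral {a..b} ?D" by simp
  have 2: "norm (u p - u a) \<le> \<Lambda> / 2 ^ n"
    using ulip[of p a] mult_left_mono[OF pa(2) \<Lambda>0] pa(1) by simp
  have 3: "norm (u b - u q) \<le> \<Lambda> / 2 ^ n"
    using ulip[of b q] mult_left_mono[OF qb(2) \<Lambda>0] qb(1) by simp
  have "w b - w a - (b - a) *\<^sub>R c = (u b - u q) + (u q - u p) + (u p - u a)"
    by (simp add: u_def algebra_simps)
  then have "norm (w b - w a - (b - a) *\<^sub>R c) \<le> norm (u b - u q) + norm (u q - u p) + norm (u p - u a)"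
    by (metis norm_triangle_mono norm_triangle_ineq order_refl)
  then show ?thesis using 1 2 3 unfolding \<Lambda>_def[symmetric] by linarith
qed

text \<open>Lebesgue's differentiation theorem for averages over the cubes with lower corner \<open>t\<close> gives the averages
to the right; the averages to the left are those of the reflected function.\<close>

lemma Lebesgue_points_two_sided:
  fixes \<psi> :: "real \<Rightarrow> real"
  assumes int: "\<And>a b. \<psi> integrable_on {a..b}"
  obtains N where "negligible N"
    "\<And>t e. t \<notin> N \<Longrightarrow> 0 < e \<Longrightarrow> \<exists>d>0. \<forall>h. 0 < h \<and> h < d \<longrightarrow>
       integral {t..t + h} \<psi> \<le> h * (\<psi> t + e) \<and> integral {t - h..t} \<psi> \<le> h * (\<psi> t + e)"
proof -
  obtain N1 where N1: "negligible N1" "\<And>t e. t \<notin> N1 \<Longrightarrow> 0 < e \<Longrightarrow>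
      \<exists>d>0. \<forall>h. 0 < h \<and> h < d \<longrightarrow> norm (integral (cbox t (t + h *\<^sub>R One)) \<psi> /\<^sub>R h ^ DIM(real) - \<psi> t) < e"
    using integrable_ccontinuous_explicit[OF int[folded cbox_interval]] by blast
  have int': "(\<lambda>t. \<psi> (- t)) integrable_on {a..b}" for a b
    using int[of "- b" "- a"] Henstock_Kurzweil_Integration.integrable_reflect_real[where f = \<psi> and a = "- b" and b = "- a"] by simp
  obtain N2 where N2: "negligible N2" "\<And>t e. t \<notin> N2 \<Longrightarrow> 0 < e \<Longrightarrow>
      \<exists>d>0. \<forall>h. 0 < h \<and> h < d \<longrightarrow> norm (integral (cbox t (t + h *\<^sub>R One)) (\<lambda>t. \<psi> (- t)) /\<^sub>R h ^ DIM(real) - \<psi> (- t)) < e"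
    using integrable_ccontinuous_explicit[OF int'[folded cbox_interval]] by blast
  have aux: "x \<le> h * (y + e)" if "norm (x /\<^sub>R h ^ DIM(real) - y) < e" "0 < h" for x y h e :: real
  proof -
    have "x / h - y < e" using that by (simp add: divide_inverse_commute abs_less_iff)
    then have "x / h < y + e" by simp
    then show ?thesis using \<open>0 < h\<close> by (simp add: divide_less_eq mult.commute)
  qed
  have "negligible (N1 \<union> uminus ` N2)"
    using N1(1) negligible_differentiable_image_negligible[OF order_refl N2(1), of uminus]
    by (simp add: linear_imp_differentiable_on linear_uminus)
  moreover have "\<exists>d>0. \<forall>h. 0 < h \<and> h < d \<longrightarrow>
       integral {t..t + h} \<psi> \<le> h * (\<psi> t + e) \<and> integral {t - h..t} \<psi> \<le> h * (\<psi> t + e)"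
    if t: "t \<notin> N1 \<union> uminus ` N2" and e: "0 < e" for t e
  proof -
    have "- t \<notin> N2" using t by (metis UnCI image_eqI minus_minus)
    then obtain d2 where d2: "d2 > 0" "\<And>h. 0 < h \<Longrightarrow> h < d2 \<Longrightarrow>
        norm (integral (cbox (- t) (- t + h *\<^sub>R One)) (\<lambda>t. \<psi> (- t)) /\<^sub>R h ^ DIM(real) - \<psi> (- (- t))) < e"
      using N2(2)[OF _ e, of "- t"] by blast
    obtain d1 where d1: "d1 > 0" "\<And>h. 0 < h \<Longrightarrow> h < d1 \<Longrightarrow>
        norm (integral (cbox t (t + h *\<^sub>R One)) \<psi> /\<^sub>R h ^ DIM(real) - \<psi> t) < e"
      using N1(2)[OF _ e, of t] t by blast
    have "integral {t - h..t} \<psi> \<le> h * (\<psi> t + e)" if "0 < h" "h < d2" for h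
    proof -
      have "integral {- t..- (t - h)} (\<lambda>t. \<psi> (- t)) = integral {t - h..t} \<psi>"
        by (rule Henstock_Kurzweil_Integration.integral_reflect_real)
      then show ?thesis using aux[OF d2(2)[OF that] that(1)] by simp
    qed
    moreover have "integral {t..t + h} \<psi> \<le> h * (\<psi> t + e)" if "0 < h" "h < d1" for h
      using aux[OF d1(2)[OF that] that(1)] by simp
    ultimately show ?thesis using d1(1) d2(1) by (intro exI[of _ "min d1 d2"]) auto
  qed
  ultimately show thesis using that by blast
qed

lemma has_vector_derivative_two_sidedI:
  fixes w :: "real \<Rightarrow> 'h::real_normed_vector"
  assumes "\<And>e. 0 < e \<Longrightarrow> \<exists>d>0. \<forall>h. 0 < h \<and> h < d \<longrightarrow>
     norm (w (t + h) - w t - h *\<^sub>R v) \<le> h * e \<and> norm (w t - w (t - h) - h *\<^sub>R v) \<le> h * e"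
  shows "(w has_vector_derivative v) (at t)"
  unfolding has_vector_derivative_def has_derivative_at_alt
proof (intro conjI allI impI)
  show "bounded_linear (\<lambda>x. x *\<^sub>R v)" by (rule bounded_linear_scaleR_left)
  fix e :: real assume "0 < e"
  from assms[OF this] obtain d where d: "d > 0" and
    dd: "\<And>h. 0 < h \<Longrightarrow> h < d \<Longrightarrow>
     norm (w (t + h) - w t - h *\<^sub>R v) \<le> h * e \<and> norm (w t - w (t - h) - h *\<^sub>R v) \<le> h * e" by blast
  have "norm (w y - w t - (y - t) *\<^sub>R v) \<le> e * norm (y - t)" if "norm (y - t) < d" for y
  proof (cases "y = t")
    case False
    show ?thesis
    proof (cases "y > t")
      case True
      then show ?thesis using dd[of "y - t"] that by (simp add: mult.commute)
    next
      case False
      then have "norm (w t - w y - (t - y) *\<^sub>R v) \<le> (t - y) * e"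
        using dd[of "t - y"] that \<open>y \<noteq> t\<close> by simp
      moreover have "w t - w y - (t - y) *\<^sub>R v = - (w y - w t - (y - t) *\<^sub>R v)" by (simp add: algebra_simps)
      ultimately have "norm (w y - w t - (y - t) *\<^sub>R v) \<le> (t - y) * e" by (metis norm_minus_cancel)
      then show ?thesis using False by (simp add: mult.commute)
    qed
  qed simp
  then show "\<exists>d>0. \<forall>y. norm (y - t) < d \<longrightarrow> norm (w y - w t - (y - t) *\<^sub>R v) \<le> e * norm (y - t)"
    using d by blast
qed

text \<open>Let \<open>f\<close> be the almost everywhere limit of a subsequence of the slopes. Passing to the limit in the
increment estimate gives \<open>norm (w b - w a - (b - a) c) \<le> \<integral> norm (f - c)\<close> for every \<open>c\<close>. All slopes lie
in one countable set, whose closure contains \<open>f t\<close> for almost every \<open>t\<close>; at a common Lebesgue point of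
the countably many scalar functions \<open>norm (f - c)\<close> the choice of \<open>c\<close> near \<open>f t\<close> shows that \<open>f t\<close> is the
derivative.\<close>

lemma lipschitz_differentiable_ae_unit:
  fixes w :: "real \<Rightarrow> 'h::{real_inner, complete_space}"
  assumes lip: "\<And>s t. norm (w t - w s) \<le> L * \<bar>t - s\<bar>"
  obtains N where "negligible N"
    "\<And>t. t \<in> {0<..<1} - N \<Longrightarrow> \<exists>v. (w has_vector_derivative v) (at t)"
proof -
  obtain r f N0 where r: "strict_mono r" and N0: "negligible N0"
    and f: "\<And>t. t \<in> {0..1} - N0 \<Longrightarrow> (\<lambda>k. dyadic_slope w (r k) t) \<longlonglongrightarrow> f t"
    using dyadic_slopes_converge_ae[OF lip] by metis
  define D where "D = range (\<lambda>(n, j::int). (2::real) ^ n *\<^sub>R (w (of_int (j + 1) / 2 ^ n) - w (of_int j / 2 ^ n)))"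
  have cD: "countable D" unfolding D_def by (rule countable_image) simp
  have inD: "dyadic_slope w n t \<in> D" for n t
    unfolding D_def dyadic_slope_def by (rule image_eqI[where x = "(n, \<lfloor>2 ^ n * t\<rfloor>)"]) auto
  define \<psi> where "\<psi> c t = (if t \<in> {0..1} - N0 then norm (f t - c) else 0)" for c t
  define F where "F c k t = (if t \<in> {0..1} - N0 then norm (dyadic_slope w (r k) t - c) else 0)" for c k t
  note db = dyadic_slope_bound[OF lip]
  have L0: "0 \<le> L" using db[of 0 0] norm_ge_zero order_trans by blast
  have Db: "norm (dyadic_slope w n t - c) \<le> L + norm c" for n t c
    using norm_triangle_ineq4[of "dyadic_slope w n t" c] db[of n t] by linarith
  have Dint: "(\<lambda>t. norm (dyadic_slope w n t - c)) integrable_on {x..y}" for x y n c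
    by (rule integrable_dyadic_slope[of "\<lambda>v. norm (v - c)" w n "L + norm c"]) (simp add: Db)
  have Fint: "(F c k has_integral integral {a..b} (\<lambda>t. norm (dyadic_slope w (r k) t - c))) {a..b}"
    if "0 \<le> a" "b \<le> 1" for a b c k
    by (rule has_integral_spike[OF N0 _ integrable_integral[OF Dint]]) (use that in \<open>auto simp: F_def\<close>)
  have conv: "\<psi> c integrable_on {a..b}"
    "(\<lambda>k. integral {a..b} (\<lambda>t. norm (dyadic_slope w (r k) t - c))) \<longlonglongrightarrow> integral {a..b} (\<psi> c)"
    if ab: "0 \<le> a" "b \<le> 1" for a b c
  proof -
    have i1: "F c k integrable_on {a..b}" for k using Fint[OF ab] by blast
    have i2: "(\<lambda>_. L + norm c) integrable_on {a..b}" by (rule integrable_const_ivl)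
    have i3: "norm (F c k x) \<le> L + norm c" for k x
      using Db L0 by (auto simp: F_def)
    have i4: "(\<lambda>k. F c k x) \<longlonglongrightarrow> \<psi> c x" for x
    proof (cases "x \<in> {0..1} - N0")
      case True
      then show ?thesis unfolding F_def \<psi>_def if_P[OF True] by (intro tendsto_intros f)
    next
      case False
      then show ?thesis unfolding F_def \<psi>_def if_not_P[OF False] by simp
    qed
    have "(\<lambda>k. integral {a..b} (F c k)) \<longlonglongrightarrow> integral {a..b} (\<psi> c)"
      by (rule dominated_convergence(2)[OF i1 i2 i3 i4])
    then show "(\<lambda>k. integral {a..b} (\<lambda>t. norm (dyadic_slope w (r k) t - c))) \<longlonglongrightarrow> integral {a..b} (\<psi> c)"
      by (simp add: integral_unique[OF Fint[OF ab]])
    show "\<psi> c integrable_on {a..b}" by (rule dominated_convergence(1)[OF i1 i2 i3 i4])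
  qed
  have bound: "norm (w b - w a - (b - a) *\<^sub>R c) \<le> integral {a..b} (\<psi> c)"
    if ab: "0 \<le> a" "a \<le> b" "b \<le> 1" for a b c
  proof (rule LIMSEQ_le_const)
    have "(\<lambda>n. inverse ((2::real) ^ n)) \<longlonglongrightarrow> 0"
      by (rule LIMSEQ_inverse_realpow_zero) simp
    then have "(\<lambda>k. inverse ((2::real) ^ r k)) \<longlonglongrightarrow> 0"
      using LIMSEQ_subseq_LIMSEQ[OF _ r] by (fastforce simp: o_def)
    then have "(\<lambda>k. 3 * (L + norm c) * inverse (2 ^ r k)) \<longlonglongrightarrow> 3 * (L + norm c) * 0"
      by (intro tendsto_intros)
    from tendsto_add[OF conv(2)[OF ab(1,3), of c] this]
    show "(\<lambda>k. integral {a..b} (\<lambda>t. norm (dyadic_slope w (r k) t - c)) + 3 * (L + norm c) * inverse (2 ^ r k))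
       \<longlonglongrightarrow> integral {a..b} (\<psi> c)" by simp
    show "\<exists>N. \<forall>n\<ge>N. norm (w b - w a - (b - a) *\<^sub>R c) \<le> 
        integral {a..b} (\<lambda>t. norm (dyadic_slope w (r n) t - c)) + 3 * (L + norm c) * inverse (2 ^ r n)"
      using dyadic_slope_increment[OF lip ab(2)] by (auto simp: divide_inverse)
  qed
  have \<psi>int: "\<psi> c integrable_on {a..b}" for a b c
  proof -
    have "(\<lambda>t. if t \<in> {0..1} then \<psi> c t else 0) integrable_on UNIV"
      using conv(1)[of 0 1 c] integrable_restrict_UNIV[of "{0..1}" "\<psi> c"] by simp
    moreover have "(\<lambda>t. if t \<in> {0..1} then \<psi> c t else 0) = \<psi> c" by (auto simp: \<psi>_def)
    ultimately have "\<psi> c integrable_on UNIV" by simp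
    then show ?thesis by (rule integrable_on_subinterval) simp
  qed
  have "\<forall>c. \<exists>N. negligible N \<and> (\<forall>t e. t \<notin> N \<longrightarrow> 0 < e \<longrightarrow> (\<exists>d>0. \<forall>h. 0 < h \<and> h < d \<longrightarrow>
       integral {t..t + h} (\<psi> c) \<le> h * (\<psi> c t + e) \<and> integral {t - h..t} (\<psi> c) \<le> h * (\<psi> c t + e)))"
    using Lebesgue_points_two_sided[OF \<psi>int] by metis
  then obtain NN where NN: "\<And>c. negligible (NN c)"
    "\<And>c t e. t \<notin> NN c \<Longrightarrow> 0 < e \<Longrightarrow> \<exists>d>0. \<forall>h. 0 < h \<and> h < d \<longrightarrow>
       integral {t..t + h} (\<psi> c) \<le> h * (\<psi> c t + e) \<and> integral {t - h..t} (\<psi> c) \<le> h * (\<psi> c t + e)"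
    by metis
  define N where "N = N0 \<union> (\<Union>(NN ` D))"
  have "negligible N"
    unfolding N_def using N0 NN(1) cD by (auto intro!: negligible_countable_Union)
  moreover have "(w has_vector_derivative f t) (at t)" if t: "t \<in> {0<..<1} - N" for t
  proof (rule has_vector_derivative_two_sidedI)
    fix e :: real assume e: "0 < e"
    have tN0: "t \<in> {0..1} - N0" using t by (auto simp: N_def)
    have "\<exists>c\<in>D. norm (f t - c) < e / 3"
    proof -
      have "\<exists>k. norm (dyadic_slope w (r k) t - f t) < e / 3"
        using LIMSEQ_D[OF f[OF tN0], of "e/3"] e by auto
      then show ?thesis using inD by (metis norm_minus_commute)
    qed
    then obtain c where c: "c \<in> D" "norm (f t - c) < e / 3" by blast
    have "t \<notin> NN c" using t c(1) by (auto simp: N_def)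
    then obtain d where d: "d > 0" and dd: "\<And>h. 0 < h \<Longrightarrow> h < d \<Longrightarrow>
       integral {t..t + h} (\<psi> c) \<le> h * (\<psi> c t + e / 3) \<and> integral {t - h..t} (\<psi> c) \<le> h * (\<psi> c t + e / 3)"
      using NN(2)[of t c "e/3"] e by auto
    have pt: "\<psi> c t \<le> e / 3" using c(2) tN0 by (simp add: \<psi>_def)
    have key: "norm (w q - w p - h *\<^sub>R f t) \<le> h * e"
      if pq: "0 \<le> p" "p \<le> q" "q \<le> 1" "q - p = h" "0 < h" and i: "integral {p..q} (\<psi> c) \<le> h * (\<psi> c t + e/3)" for p q h
    proof -
      have "norm (w q - w p - h *\<^sub>R f t) \<le> norm (w q - w p - h *\<^sub>R c) + norm (h *\<^sub>R (c - f t))"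
        using norm_triangle_ineq[of "w q - w p - h *\<^sub>R c" "h *\<^sub>R (c - f t)"] by (simp add: scaleR_diff_right)
      also have "norm (h *\<^sub>R (c - f t)) = h * norm (c - f t)" using pq by simp
      also have "norm (w q - w p - h *\<^sub>R c) + h * norm (c - f t) \<le> h * (e/3 + e/3) + h * (e / 3)"
      proof (rule add_mono)
        have "norm (w q - w p - h *\<^sub>R c) \<le> h * (\<psi> c t + e/3)" using bound[OF pq(1-3), of c] i pq(4) by simp
        also have "\<dots> \<le> h * (e/3 + e/3)" using pt pq(5) by (intro mult_left_mono) auto
        finally show "norm (w q - w p - h *\<^sub>R c) \<le> h * (e/3 + e/3)" .
        show "h * norm (c - f t) \<le> h * (e/3)"
          using c(2) pq(5) by (intro mult_left_mono) (auto simp: norm_minus_commute)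
      qed
      finally show ?thesis by (simp add: algebra_simps)
    qed
    show "\<exists>d>0. \<forall>h. 0 < h \<and> h < d \<longrightarrow>
     norm (w (t + h) - w t - h *\<^sub>R f t) \<le> h * e \<and> norm (w t - w (t - h) - h *\<^sub>R f t) \<le> h * e"
      using t d by (intro exI[of _ "min d (min t (1 - t))"] conjI allI impI key) (auto simp: dd)
  qed
  ultimately show thesis using that by blast
qed

text \<open>The Radon-Nikodym property of Hilbert spaces, for Lipschitz functions.\<close>

proposition lipschitz_differentiable_ae:
  fixes w :: "real \<Rightarrow> 'h::{real_inner, complete_space}"
  assumes lip: "\<And>s t. norm (w t - w s) \<le> L * \<bar>t - s\<bar>"
  obtains N where "negligible N" "\<And>t. t \<notin> N \<Longrightarrow> \<exists>v. (w has_vector_derivative v) (at t)"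
proof -
  have "\<exists>N. negligible N \<and> (\<forall>t. t \<in> {0<..<1} - N \<longrightarrow> (\<exists>v. ((\<lambda>s. w (s + of_int k)) has_vector_derivative v) (at t)))" for k :: int
    using lipschitz_differentiable_ae_unit[of "\<lambda>s. w (s + of_int k)" L] lip
    by (metis (no_types, lifting) add_diff_cancel_right)
  then obtain N where N: "\<And>k. negligible (N k)"
    "\<And>k t. t \<in> {0<..<1} - N k \<Longrightarrow> \<exists>v. ((\<lambda>s. w (s + of_int k)) has_vector_derivative v) (at t)"
    by metis
  define M where "M = range real_of_int \<union> (\<Union>k. (+) (of_int k) ` N k)"
  have "negligible (range real_of_int)" 
    unfolding negligible_iff_null_sets
    by (intro null_sets_completionI countable_imp_null_set_lborel countable_image) simp
  then have "negligible M"
    unfolding M_def by (intro negligible_Un negligible_countable_Union) (auto intro: negligible_translation N)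
  moreover have "\<exists>v. (w has_vector_derivative v) (at t)" if t: "t \<notin> M" for t
  proof -
    define k where "k = \<lfloor>t\<rfloor>"
    have "t \<noteq> of_int k" using t by (auto simp: M_def)
    then have "t - of_int k \<in> {0<..<1}" by (simp add: k_def) linarith
    moreover have "t - of_int k \<notin> N k"
    proof
      assume "t - of_int k \<in> N k"
      then have "t \<in> (+) (of_int k) ` N k" by (metis add.commute diff_add_cancel image_eqI)
      then show False using t by (auto simp: M_def)
    qed
    ultimately obtain v where v: "((\<lambda>s. w (s + of_int k)) has_vector_derivative v) (at (t - of_int k))"
      using N(2) by blast
    have "((\<lambda>s. s - of_int k) has_vector_derivative 1) (at t)"
      by (auto intro!: derivative_eq_intros)
    from vector_diff_chain_at[OF this v]
    show ?thesis by (auto simp: o_def)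
  qed
  ultimately show thesis using that by blast
qed

lemma outside_negligible:
  assumes "negligible N" "a < (b::real)"
  obtains t where "a < t" "t < b" "t \<notin> N"
proof -
  have "\<not> {a<..<b} \<subseteq> N"
    using assms negligible_subset[OF assms(1), of "{a<..<b}"] negligible_interval(2)[of a b] by auto
  then show thesis using that by (meson greaterThanLessThan_iff subsetI)
qed

lemma AE_lebesgue_iff_negligible:
  "(AE t in lebesgue. P t) \<longleftrightarrow> (\<exists>N. negligible N \<and> (\<forall>t. t \<notin> N \<longrightarrow> P t))"
  unfolding eventually_ae_filter negligible_iff_null_sets by auto

text \<open>The point \<open>t\<close> lies in the cell whose slope is taken, so the two one-sided errors add up to a multiple
of the length of the cell.\<close>

lemma dyadic_slope_tendsto:
  fixes w :: "real \<Rightarrow> 'h::real_normed_vector"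
  assumes "(w has_vector_derivative v) (at t)"
  shows "(\<lambda>n. dyadic_slope w n t) \<longlonglongrightarrow> v"
proof (rule LIMSEQ_I)
  fix e :: real assume "0 < e"
  then obtain d where d: "d > 0" "\<And>y. norm (y - t) < d \<Longrightarrow> norm (w y - w t - (y - t) *\<^sub>R v) \<le> e / 2 * norm (y - t)"
    using assms[unfolded has_vector_derivative_def has_derivative_at_alt] by (meson half_gt_zero)
  have "(\<lambda>n. inverse ((2::real) ^ n)) \<longlonglongrightarrow> 0" by (rule LIMSEQ_inverse_realpow_zero) simp
  from LIMSEQ_D[OF this d(1)] obtain n0 where n0: "\<And>n. n \<ge> n0 \<Longrightarrow> inverse ((2::real) ^ n) < d"
    by auto
  have "norm (dyadic_slope w n t - v) < e" if "n \<ge> n0" for n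
  proof -
    define p where "p = of_int \<lfloor>2 ^ n * t\<rfloor> / (2::real) ^ n"
    define q where "q = of_int (\<lfloor>2 ^ n * t\<rfloor> + 1) / (2::real) ^ n"
    have qp: "q - p = inverse (2 ^ n)" by (simp add: p_def q_def field_simps)
    have "p \<le> t" "t < q"
      unfolding p_def q_def by (simp_all add: pos_divide_le_eq pos_less_divide_eq mult.commute)
    then have "norm (q - t) < d" "norm (p - t) < d" using qp n0[OF that] by auto
    then have "norm ((w q - w t - (q - t) *\<^sub>R v) - (w p - w t - (p - t) *\<^sub>R v)) \<le> e / 2 * norm (q - t) + e / 2 * norm (p - t)"
      by (intro order_trans[OF norm_triangle_ineq4] add_mono d(2))
    also have "\<dots> = e / 2 * (q - p)" using \<open>p \<le> t\<close> \<open>t < q\<close> by (simp add: field_simps)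
    finally have "norm (w q - w p - (q - p) *\<^sub>R v) \<le> e / 2 * (q - p)" by (simp add: algebra_simps)
    moreover have "dyadic_slope w n t - v = 2 ^ n *\<^sub>R (w q - w p - (q - p) *\<^sub>R v)"
      unfolding dyadic_slope_def p_def[symmetric] q_def[symmetric] by (simp add: qp scaleR_diff_right)
    ultimately have "norm (dyadic_slope w n t - v) \<le> 2 ^ n * (e / 2 * (q - p))" by simp
    also have "\<dots> = e / 2" by (simp add: qp)
    finally show ?thesis using \<open>0 < e\<close> by simp
  qed
  then show "\<exists>no. \<forall>n\<ge>no. norm (dyadic_slope w n t - v) < e" by blast
qed

lemma simple_function_dyadic_slope:
  "simple_function (lebesgue_on {a..b}) (dyadic_slope w n)"
proof -
  have "simple_function (lebesgue_on {a..b}) (\<lambda>t. \<lfloor>2 ^ n * t\<rfloor>)"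
    unfolding simple_function_def
  proof (intro conjI ballI)
    have "(\<lambda>t. \<lfloor>2 ^ n * t\<rfloor>) ` {a..b} \<subseteq> {\<lfloor>2 ^ n * a\<rfloor>..\<lfloor>2 ^ n * b\<rfloor>}"
      by (auto intro!: floor_mono)
    then show "finite ((\<lambda>t. \<lfloor>2 ^ n * t\<rfloor>) ` space (lebesgue_on {a..b}))"
      using finite_subset by (simp add: space_restrict_space) blast
    fix x
    have "(\<lambda>t::real. \<lfloor>2 ^ n * t\<rfloor>) \<in> lborel \<rightarrow>\<^sub>M count_space UNIV" by measurable
    then have "(\<lambda>t::real. \<lfloor>2 ^ n * t\<rfloor>) \<in> lebesgue \<rightarrow>\<^sub>M count_space UNIV" by (rule measurable_completion)
    then have "(\<lambda>t::real. \<lfloor>2 ^ n * t\<rfloor>) \<in> lebesgue_on {a..b} \<rightarrow>\<^sub>M count_space UNIV" by (rule measurable_restrict_space1)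
    then show "(\<lambda>t. \<lfloor>2 ^ n * t\<rfloor>) -` {x} \<inter> space (lebesgue_on {a..b}) \<in> sets (lebesgue_on {a..b})"
      by (rule measurable_sets) simp
  qed
  from simple_function_compose1[OF this, of "\<lambda>j. 2 ^ n *\<^sub>R (w (of_int (j + 1) / 2 ^ n) - w (of_int j / 2 ^ n))"]
  show ?thesis by (simp add: dyadic_slope_def[abs_def])
qed

text \<open>Wherever it exists the derivative is the limit of the dyadic slopes, which are simple functions bounded
by \<open>L\<close>; hence it is an \<open>L1_on\<close> function, and \<open>w\<close> is its indefinite integral.\<close>

proposition lipschitz_abs_continuous:
  fixes w :: "real \<Rightarrow> 'h::{real_inner, complete_space}"
  assumes lip0: "\<And>s t. 0 \<le> s \<Longrightarrow> 0 \<le> t \<Longrightarrow> norm (w t - w s) \<le> L * \<bar>t - s\<bar>"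
  shows "abs_continuous w"
    and "\<exists>N. negligible N \<and> (\<forall>t. 0 < t \<longrightarrow> t \<notin> N \<longrightarrow> (\<exists>v. (w has_vector_derivative v) (at t)))"
proof -
  define W where "W t = w (max 0 t)" for t
  have L0: "0 \<le> L" using order_trans[OF norm_ge_zero lip0[of 0 1]] by simp
  have lip: "norm (W t - W s) \<le> L * \<bar>t - s\<bar>" for s t
  proof -
    have "norm (W t - W s) \<le> L * \<bar>max 0 t - max 0 s\<bar>" unfolding W_def by (rule lip0) auto
    also have "\<dots> \<le> L * \<bar>t - s\<bar>" using L0 by (intro mult_left_mono) auto
    finally show ?thesis .
  qed
  obtain N where N: "negligible N" "\<And>t. t \<notin> N \<Longrightarrow> \<exists>v. (W has_vector_derivative v) (at t)"
    using lipschitz_differentiable_ae[OF lip] by metis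
  define f where "f t = (if t \<in> N then 0 else vector_derivative W (at t))" for t
  have der: "(W has_vector_derivative f t) (at t)" if "t \<notin> N" for t
    using N(2)[OF that] that vector_derivative_works[of W "at t"] by (auto simp: f_def differentiableI_vector)
  have tends: "(\<lambda>n. dyadic_slope W n t) \<longlonglongrightarrow> f t" if "t \<notin> N" for t
    by (rule dyadic_slope_tendsto[OF der[OF that]])
  have Dint: "(\<lambda>t. norm (dyadic_slope W n t)) integrable_on {x..y}" for x y n
    by (rule integrable_dyadic_slope[of "\<lambda>v. norm v" W n L]) (simp add: dyadic_slope_bound[OF lip])
  have fint: "(\<lambda>t. norm (f t)) integrable_on {0..T}" for T
  proof (rule dominated_convergence(1))
    show "(\<lambda>t. if t \<in> N then 0 else norm (dyadic_slope W n t)) integrable_on {0..T}" for n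
      by (rule integrable_spike[OF Dint N(1)]) auto
    show "(\<lambda>_. L) integrable_on {0..T}" by (rule integrable_const_ivl)
    show "norm (if t \<in> N then 0 else norm (dyadic_slope W n t)) \<le> L" for n t
      using L0 dyadic_slope_bound[OF lip] by auto
    show "(\<lambda>n. if t \<in> N then 0 else norm (dyadic_slope W n t)) \<longlonglongrightarrow> norm (f t)" for t
      using tendsto_norm[OF tends[of t]] by (cases "t \<in> N") (auto simp: f_def)
  qed
  have L1: "L1_on {0..T} f" for T
    unfolding L1_on_def
  proof (intro conjI exI allI)
    show "simple_function (lebesgue_on {0..T}) (dyadic_slope W i)" for i
      by (rule simple_function_dyadic_slope)
    have "AE t in lebesgue. t \<in> {0..T} \<longrightarrow> (\<lambda>i. dyadic_slope W i t) \<longlonglongrightarrow> f t"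
      unfolding AE_lebesgue_iff_negligible using N(1) tends by blast
    then show "AE t in lebesgue_on {0..T}. (\<lambda>i. dyadic_slope W i t) \<longlonglongrightarrow> f t"
      by (subst AE_restrict_space_iff) auto
    have "(\<lambda>t. norm (f t)) absolutely_integrable_on {0..T}"
      by (rule nonnegative_absolutely_integrable_1[OF fint]) simp
    then show "integrable (lebesgue_on {0..T}) (\<lambda>t. norm (f t))"
      by (rule absolutely_integrable_imp_integrable) simp
  qed
  have FTC: "(f has_integral (w t - w 0)) {0..t}" if "0 \<le> t" for t
  proof -
    have "(f has_integral (W t - W 0)) {0..t}"
    proof (rule fundamental_theorem_dominated[OF that N(1), of "\<lambda>_. L"])
      show "(\<lambda>_. L) integrable_on {0..t}" by (rule integrable_const_ivl)
      show "norm (W v - W u) \<le> integral {u..v} (\<lambda>_. L)" if "u \<le> v" for u v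
        using lip[of v u] that by (simp add: mult.commute)
      show "(W has_vector_derivative f u) (at u within {0..t})" if "u \<in> {0..t} - N" for u
        using der[of u] that by (auto intro: has_vector_derivative_at_within)
    qed
    then show ?thesis using that by (simp add: W_def)
  qed
  show "abs_continuous w"
    unfolding abs_continuous_def
    by (intro allI impI exI[of _ "w 0"] exI[of _ f] conjI ballI L1 FTC) auto
  have "(w has_vector_derivative f t) (at t)" if "0 < t" "t \<notin> N" for t
    by (rule has_vector_derivative_transform_within_open[OF der[OF that(2)], of "{0<..}"])
       (use that in \<open>auto simp: W_def\<close>)
  then show "\<exists>N. negligible N \<and> (\<forall>t. 0 < t \<longrightarrow> t \<notin> N \<longrightarrow> (\<exists>v. (w has_vector_derivative v) (at t)))"
    using N(1) by blast
qed

section \<open>Dissipative evolutions\<close>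

definition dissipative :: "('h::real_inner \<Rightarrow> 'h set) \<Rightarrow> bool" where
  "dissipative M \<longleftrightarrow> (\<forall>x y. \<forall>d\<in>M x. \<forall>e\<in>M y. (d - e) \<bullet> (x - y) \<le> 0)"

text \<open>A solution concept that is weaker than \<open>strong_solution\<close>: of absolute continuity it keeps just the
domination of increments by an integrable function, and membership in the domain is required only
almost everywhere. Contraction still holds for it, and in contrast to \<open>strong_solution\<close> it is
evidently stable under time shifts.\<close>

definition trajectory :: "('h::real_normed_vector \<Rightarrow> 'h set) \<Rightarrow> (real \<Rightarrow> 'h) \<Rightarrow> bool" where
  "trajectory M w \<longleftrightarrow>
     (\<forall>T\<ge>0. \<exists>g. g integrable_on {0..T} \<and> (\<forall>t. 0 \<le> g t) \<and>
        (\<forall>s t. 0 \<le> s \<longrightarrow> s \<le> t \<longrightarrow> t \<le> T \<longrightarrow> norm (w t - w s) \<le> integral {s..t} g)) \<and>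
     (\<exists>N. negligible N \<and> (\<forall>t. 0 < t \<longrightarrow> t \<notin> N \<longrightarrow> (\<exists>d\<in>M (w t). (w has_vector_derivative d) (at t))))"

lemma strong_solution_trajectory:
  fixes w :: "real \<Rightarrow> 'h::real_inner"
  assumes "strong_solution M w"
  shows "trajectory M w"
  unfolding trajectory_def
proof (intro conjI allI impI)
  show "\<exists>N. negligible N \<and> (\<forall>t. 0 < t \<longrightarrow> t \<notin> N \<longrightarrow> (\<exists>d\<in>M (w t). (w has_vector_derivative d) (at t)))"
    using assms unfolding strong_solution_def AE_lebesgue_iff_negligible by blast
  fix T :: real assume T: "0 \<le> T"
  then obtain c f where L1: "L1_on {0..T} f" and int: "\<And>t. t \<in> {0..T} \<Longrightarrow> (f has_integral (w t - c)) {0..t}"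
    using assms unfolding strong_solution_def abs_continuous_def by meson
  have "integrable (lebesgue_on {0..T}) (\<lambda>t. norm (f t))" using L1 by (simp add: L1_on_def)
  then have fint: "(\<lambda>t. norm (f t)) integrable_on {0..T}" by (rule integrable_on_lebesgue_on) simp
  have "norm (w t - w s) \<le> integral {s..t} (\<lambda>t. norm (f t))" if st: "0 \<le> s" "s \<le> t" "t \<le> T" for s t
  proof (rule weak_has_integral_norm_le[OF _ integrable_integral])
    show "(\<lambda>t. norm (f t)) integrable_on {s..t}"
      by (rule integrable_subinterval_real[OF fint]) (use st in auto)
    fix e
    have t: "((\<lambda>r. f r \<bullet> e) has_integral (w t - c) \<bullet> e) {0..t}"
      and s: "((\<lambda>r. f r \<bullet> e) has_integral (w s - c) \<bullet> e) {0..s}"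
      using int[of t] int[of s] st by (auto intro: has_integral_inner)
    have i: "(\<lambda>r. f r \<bullet> e) integrable_on {0..t}" using t by blast
    have "integral {0..s} (\<lambda>r. f r \<bullet> e) + integral {s..t} (\<lambda>r. f r \<bullet> e) = integral {0..t} (\<lambda>r. f r \<bullet> e)"
      by (rule Henstock_Kurzweil_Integration.integral_combine[OF st(1,2) i])
    then have "integral {s..t} (\<lambda>r. f r \<bullet> e) = (w t - w s) \<bullet> e"
      using integral_unique[OF t] integral_unique[OF s] by (simp add: inner_diff_left)
    moreover have "(\<lambda>r. f r \<bullet> e) integrable_on {s..t}"
      using i by (rule integrable_subinterval_real) (use st in auto)
    ultimately show "((\<lambda>r. f r \<bullet> e) has_integral (w t - w s) \<bullet> e) {s..t}"
      by (metis integrable_integral)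
  qed simp
  then show "\<exists>g. g integrable_on {0..T} \<and> (\<forall>t. 0 \<le> g t) \<and>
        (\<forall>s t. 0 \<le> s \<longrightarrow> s \<le> t \<longrightarrow> t \<le> T \<longrightarrow> norm (w t - w s) \<le> integral {s..t} g)"
    using fint by (intro exI[of _ "\<lambda>t. norm (f t)"]) auto
qed

lemma trajectory_shift:
  assumes w: "trajectory M w" and h: "0 \<le> h"
  shows "trajectory M (\<lambda>t. w (t + h))"
  unfolding trajectory_def
proof (intro conjI allI impI)
  obtain N where N: "negligible N" "\<And>t. 0 < t \<Longrightarrow> t \<notin> N \<Longrightarrow> \<exists>d\<in>M (w t). (w has_vector_derivative d) (at t)"
    using w unfolding trajectory_def by blast
  have "\<exists>d\<in>M (w (t + h)). ((\<lambda>t. w (t + h)) has_vector_derivative d) (at t)"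
    if t: "0 < t" "t \<notin> (+) (- h) ` N" for t
  proof -
    have "t + h \<notin> N"
    proof
      assume "t + h \<in> N"
      then have "t \<in> (+) (- h) ` N" by (intro image_eqI[of _ _ "t + h"]) auto
      then show False using t by simp
    qed
    then obtain d where d: "d \<in> M (w (t + h))" "(w has_vector_derivative d) (at (t + h))"
      using N(2)[of "t + h"] add_pos_nonneg[OF t(1) h] by blast
    have "((\<lambda>t. t + h) has_vector_derivative 1) (at t)" by (auto intro!: derivative_eq_intros)
    from vector_diff_chain_at[OF this d(2)] d(1) show ?thesis by (auto simp: o_def)
  qed
  moreover have "negligible ((+) (- h) ` N)" using N(1) by (rule negligible_translation)
  ultimately show "\<exists>N. negligible N \<and> (\<forall>t. 0 < t \<longrightarrow> t \<notin> N \<longrightarrow>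
      (\<exists>d\<in>M (w (t + h)). ((\<lambda>t. w (t + h)) has_vector_derivative d) (at t)))" by blast
  fix T :: real assume "0 \<le> T"
  then have "0 \<le> T + h" using h by simp
  then obtain g where g: "g integrable_on {0..T + h}" "\<And>t. 0 \<le> g t"
    "\<And>s t. 0 \<le> s \<Longrightarrow> s \<le> t \<Longrightarrow> t \<le> T + h \<Longrightarrow> norm (w t - w s) \<le> integral {s..t} g"
    using w unfolding trajectory_def by meson
  have eq: "integral {s..t} (\<lambda>r. g (r + h)) = integral {s + h..t + h} g" for s t
    using integral_shift_real_ivl[where a = "s + h" and b = "t + h" and c = h and f = g] by simp
  have "(\<lambda>r. g (r + h)) integrable_on {0 - h..T}"
    using integrable_shift_real_ivl[OF g(1), of h] by simp
  then have "(\<lambda>r. g (r + h)) integrable_on {0..T}"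
    by (rule integrable_subinterval_real) (use h in auto)
  moreover have "norm (w (t + h) - w (s + h)) \<le> integral {s..t} (\<lambda>r. g (r + h))"
    if "0 \<le> s" "s \<le> t" "t \<le> T" for s t
    unfolding eq by (rule g(3)) (use that h in auto)
  ultimately show "\<exists>g. g integrable_on {0..T} \<and> (\<forall>t. 0 \<le> g t) \<and>
        (\<forall>s t. 0 \<le> s \<longrightarrow> s \<le> t \<longrightarrow> t \<le> T \<longrightarrow> norm (w (t + h) - w (s + h)) \<le> integral {s..t} g)"
    using g(2) by (intro exI[of _ "\<lambda>r. g (r + h)"]) auto
qed

text \<open>Dissipativity makes the derivative of the squared distance nonpositive almost everywhere, and the
squared distance inherits dominated increments because the difference is bounded on bounded
intervals.\<close>

proposition dissipative_contraction:
  fixes v w :: "real \<Rightarrow> 'h::real_inner"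
  assumes M: "dissipative M" and v: "trajectory M v" and w: "trajectory M w" and st: "0 \<le> s" "s \<le> t"
  shows "norm (v t - w t) \<le> norm (v s - w s)"
proof -
  define u where "u r = v r - w r" for r
  obtain g1 where g1: "g1 integrable_on {0..t}" "\<And>t. 0 \<le> g1 t"
    "\<And>p q. 0 \<le> p \<Longrightarrow> p \<le> q \<Longrightarrow> q \<le> t \<Longrightarrow> norm (v q - v p) \<le> integral {p..q} g1"
    using v st unfolding trajectory_def by (meson order_trans)
  obtain g2 where g2: "g2 integrable_on {0..t}" "\<And>t. 0 \<le> g2 t"
    "\<And>p q. 0 \<le> p \<Longrightarrow> p \<le> q \<Longrightarrow> q \<le> t \<Longrightarrow> norm (w q - w p) \<le> integral {p..q} g2"
    using w st unfolding trajectory_def by (meson order_trans)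
  obtain N1 where N1: "negligible N1" "\<And>t. 0 < t \<Longrightarrow> t \<notin> N1 \<Longrightarrow> \<exists>d\<in>M (v t). (v has_vector_derivative d) (at t)"
    using v unfolding trajectory_def by blast
  obtain N2 where N2: "negligible N2" "\<And>t. 0 < t \<Longrightarrow> t \<notin> N2 \<Longrightarrow> \<exists>d\<in>M (w t). (w has_vector_derivative d) (at t)"
    using w unfolding trajectory_def by blast
  define g where "g r = g1 r + g2 r" for r
  have gi: "g integrable_on {p..q}" if "0 \<le> p" "q \<le> t" for p q
  proof -
    have "g integrable_on {0..t}" unfolding g_def using g1(1) g2(1) by (rule integrable_add)
    then show ?thesis by (rule integrable_subinterval_real) (use that in auto)
  qed
  have g0: "0 \<le> g r" for r using g1(2) g2(2) by (simp add: g_def)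
  have ug: "norm (u q - u p) \<le> integral {p..q} g" if "0 \<le> p" "p \<le> q" "q \<le> t" for p q
  proof -
    have "u q - u p = (v q - v p) - (w q - w p)" by (simp add: u_def)
    then have "norm (u q - u p) \<le> norm (v q - v p) + norm (w q - w p)" by (metis norm_triangle_ineq4)
    also have "\<dots> \<le> integral {p..q} g1 + integral {p..q} g2" using that by (intro add_mono g1(3) g2(3))
    also have "\<dots> = integral {p..q} g" unfolding g_def
      by (rule integral_add[symmetric])
         (use integrable_subinterval_real[OF g1(1)] integrable_subinterval_real[OF g2(1)] that in auto)
    finally show ?thesis .
  qed
  define B where "B = norm (u 0) + integral {0..t} g"
  have uB: "norm (u r) \<le> B" if "0 \<le> r" "r \<le> t" for r
  proof -
    have "norm (u r) \<le> norm (u 0) + norm (u r - u 0)" by (metis norm_triangle_sub)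
    also have "norm (u r - u 0) \<le> integral {0..r} g" using that by (intro ug) auto
    also have "\<dots> \<le> integral {0..t} g"
      by (rule integral_subset_le) (use that gi g0 in auto)
    finally show ?thesis by (simp add: B_def)
  qed
  have "\<forall>r. \<exists>d. 0 < r \<longrightarrow> r \<notin> N1 \<union> N2 \<longrightarrow> (u has_vector_derivative d) (at r) \<and> d \<bullet> u r \<le> 0"
  proof
    fix r
    show "\<exists>d. 0 < r \<longrightarrow> r \<notin> N1 \<union> N2 \<longrightarrow> (u has_vector_derivative d) (at r) \<and> d \<bullet> u r \<le> 0"
    proof (cases "0 < r \<and> r \<notin> N1 \<union> N2")
      case True
      then obtain d e where "d \<in> M (v r)" "(v has_vector_derivative d) (at r)"
        "e \<in> M (w r)" "(w has_vector_derivative e) (at r)" using N1(2)[of r] N2(2)[of r] by blast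
      then have "(u has_vector_derivative (d - e)) (at r) \<and> (d - e) \<bullet> u r \<le> 0"
        using M unfolding u_def[abs_def] dissipative_def by (auto intro: has_vector_derivative_diff)
      then show ?thesis by blast
    qed blast
  qed
  then obtain D where D: "\<And>r. 0 < r \<Longrightarrow> r \<notin> N1 \<union> N2 \<Longrightarrow> (u has_vector_derivative D r) (at r) \<and> D r \<bullet> u r \<le> 0"
    by metis
  define N where "N = N1 \<union> N2 \<union> {0}"
  define F where "F r = (if r \<in> N then 0 else 2 * (D r \<bullet> u r))" for r
  have "(F has_integral (u t \<bullet> u t - u s \<bullet> u s)) {s..t}"
  proof (rule fundamental_theorem_dominated[OF st(2), of N "\<lambda>r. 2 * B * g r" "\<lambda>r. u r \<bullet> u r"])
    show "negligible N" unfolding N_def using N1(1) N2(1) by simp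
    show "(\<lambda>r. 2 * B * g r) integrable_on {s..t}" using integrable_on_mult_right[OF gi[of s t], of "2 * B"] st by simp
    fix p q assume pq: "s \<le> p" "p \<le> q" "q \<le> t"
    have "u q \<bullet> u q - u p \<bullet> u p = (u q - u p) \<bullet> (u q + u p)" by (simp add: algebra_simps inner_commute)
    then have "norm (u q \<bullet> u q - u p \<bullet> u p) \<le> norm (u q - u p) * norm (u q + u p)"
      by (simp add: Cauchy_Schwarz_ineq2)
    also have "\<dots> \<le> integral {p..q} g * (2 * B)"
    proof (rule mult_mono)
      show "norm (u q - u p) \<le> integral {p..q} g" using ug pq st by auto
      show "norm (u q + u p) \<le> 2 * B"
        using norm_triangle_ineq[of "u q" "u p"] uB[of q] uB[of p] pq st by auto
      show "0 \<le> integral {p..q} g" using gi g0 pq st by (intro integral_nonneg) auto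
    qed simp
    also have "\<dots> = integral {p..q} (\<lambda>r. 2 * B * g r)" by (simp add: mult.commute)
    finally show "norm (u q \<bullet> u q - u p \<bullet> u p) \<le> integral {p..q} (\<lambda>r. 2 * B * g r)" .
  next
    fix r assume r: "r \<in> {s..t} - N"
    then have "(u has_vector_derivative D r) (at r)" using D[of r] st by (auto simp: N_def)
    then have du: "(u has_derivative (\<lambda>h. h *\<^sub>R D r)) (at r)" by (simp add: has_vector_derivative_def)
    have "((\<lambda>r. u r \<bullet> u r) has_derivative (\<lambda>h. u r \<bullet> (h *\<^sub>R D r) + (h *\<^sub>R D r) \<bullet> u r)) (at r)"
      by (rule has_derivative_inner[OF du du])
    then have "((\<lambda>r. u r \<bullet> u r) has_vector_derivative F r) (at r)"
      using r by (simp add: has_vector_derivative_def F_def inner_commute algebra_simps mult_2_right)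
    then show "((\<lambda>r. u r \<bullet> u r) has_vector_derivative F r) (at r within {s..t})"
      by (rule has_vector_derivative_at_within)
  qed
  moreover have "((\<lambda>_. 0) has_integral 0) {s..t}" by (rule has_integral_0)
  ultimately have "u t \<bullet> u t - u s \<bullet> u s \<le> (0::real)"
  proof (rule has_integral_le)
    fix r assume "r \<in> {s..t}"
    then show "F r \<le> 0" using D[of r] st by (auto simp: F_def N_def)
  qed
  then have "(norm (u t))\<^sup>2 \<le> (norm (u s))\<^sup>2" by (simp add: power2_norm_eq_inner)
  then show ?thesis unfolding u_def by (rule power2_le_imp_le) simp
qed

text \<open>Start at a time \<open>t0\<close> of differentiability. Comparing the trajectory with its own shift by \<open>h\<close> shows that
\<open>norm (w (t + h) - w t)\<close> decreases in \<open>t\<close>; so the speed at \<open>t0\<close> bounds all later increments.\<close>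

lemma trajectory_eventually_lipschitz:
  fixes w :: "real \<Rightarrow> 'h::real_inner"
  assumes M: "dissipative M" and w: "trajectory M w"
  obtains t0 L where "0 < t0" "\<And>s t. 0 \<le> s \<Longrightarrow> 0 \<le> t \<Longrightarrow> norm (w (t + t0) - w (s + t0)) \<le> L * \<bar>t - s\<bar>"
proof -
  obtain N where N: "negligible N" "\<And>t. 0 < t \<Longrightarrow> t \<notin> N \<Longrightarrow> \<exists>d\<in>M (w t). (w has_vector_derivative d) (at t)"
    using w unfolding trajectory_def by blast
  obtain t0 where "0 < t0" "t0 \<notin> N" using outside_negligible[OF N(1), of 0 1] by auto
  then obtain d where d: "(w has_vector_derivative d) (at t0)" using N(2) by blast
  have mono: "norm (w (p + h) - w p) \<le> norm (w (t0 + h) - w t0)" if "t0 \<le> p" "0 \<le> h" for p h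
    using dissipative_contraction[OF M trajectory_shift[OF w that(2)] w _ that(1)] \<open>0 < t0\<close> by simp
  have step: "norm (w (p + x) - w p) \<le> norm d * x" if p: "t0 \<le> p" and x: "0 < x" for p x
  proof (rule field_le_epsilon)
    fix e :: real assume "0 < e"
    then have ex: "0 < e / x" using x by simp
    obtain \<delta> where \<delta>: "0 < \<delta>" "\<And>y. norm (y - t0) < \<delta> \<Longrightarrow> norm (w y - w t0 - (y - t0) *\<^sub>R d) \<le> e / x * norm (y - t0)"
      using d[unfolded has_vector_derivative_def has_derivative_at_alt] ex by blast
    obtain n where n: "inverse (real (Suc n)) < \<delta> / x"
      using reals_Archimedean[of "\<delta> / x"] \<delta>(1) x by auto
    \<comment> \<open>cut \<open>[p, p + x]\<close> into pieces so short that each is compared with a difference quotient at \<open>t0\<close>\<close>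
    define h where "h = x / Suc n"
    have h0: "0 \<le> h" using x by (simp add: h_def)
    have "h < \<delta>" using n x by (simp add: h_def field_simps)
    then have "norm (w (t0 + h) - w t0 - h *\<^sub>R d) \<le> e / x * h" using \<delta>(2)[of "t0 + h"] h0 by simp
    then have h1: "norm (w (t0 + h) - w t0) \<le> (norm d + e / x) * h"
      using norm_triangle_ineq2[of "w (t0 + h) - w t0" "h *\<^sub>R d"] h0 by (simp add: algebra_simps)
    have "norm (w (p + real k * h) - w p) \<le> real k * norm (w (t0 + h) - w t0)" for k
    proof (induction k)
      case (Suc k)
      have "norm (w (p + real k * h + h) - w (p + real k * h)) \<le> norm (w (t0 + h) - w t0)"
        using p h0 by (intro mono) (simp_all add: add_increasing2)
      then show ?case using Suc norm_triangle_ineq[of "w (p + real k * h + h) - w (p + real k * h)" "w (p + real k * h) - w p"]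
        by (simp add: algebra_simps)
    qed simp
    from this[of "Suc n"] have "norm (w (p + x) - w p) \<le> Suc n * norm (w (t0 + h) - w t0)"
      by (simp add: h_def)
    also have "\<dots> \<le> Suc n * ((norm d + e / x) * h)" by (intro mult_left_mono h1) simp
    also have "\<dots> = (norm d + e / x) * (Suc n * h)" by (simp only: ac_simps)
    also have "Suc n * h = x" by (simp add: h_def)
    also have "(norm d + e / x) * x = norm d * x + e" using x by (simp add: distrib_right)
    finally show "norm (w (p + x) - w p) \<le> norm d * x + e" .
  qed
  have "norm (w (t + t0) - w (s + t0)) \<le> norm d * \<bar>t - s\<bar>" if "0 \<le> s" "0 \<le> t" for s t
  proof (cases "s = t")
    case False
    then consider "s < t" | "t < s" by linarith
    then show ?thesis
    proof cases
      case 1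
      then show ?thesis using step[of "s + t0" "t - s"] that by (simp add: algebra_simps)
    next
      case 2
      then show ?thesis using step[of "t + t0" "s - t"] that
        by (simp add: algebra_simps norm_minus_commute)
    qed
  qed simp
  then show thesis using that \<open>0 < t0\<close> by blast
qed

section \<open>Closedness of the closed-loop operator\<close>

text \<open>The closed convex hull of the velocities of norm at most \<open>L\<close> that \<open>M\<close> offers near \<open>p\<close>. Mean velocities
of \<open>L\<close>-Lipschitz solutions passing close to \<open>p\<close> lie in these sets.\<close>

definition local_hull :: "('h::real_normed_vector \<Rightarrow> 'h set) \<Rightarrow> 'h \<Rightarrow> real \<Rightarrow> nat \<Rightarrow> 'h set" where
  "local_hull M p L m = closure (convex hull {d. \<exists>q. dist q p < inverse (Suc m) \<and> d \<in> M q \<and> norm d \<le> L})"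

text \<open>For maximal dissipative operators this follows from the affine inequalities that describe the graph.
It says that limits of solutions again solve the inclusion: what passes to the limit is not a single
velocity but mean velocities, and the points where they are taken vary.\<close>

definition hull_closed :: "('h::real_normed_vector \<Rightarrow> 'h set) \<Rightarrow> bool" where
  "hull_closed M \<longleftrightarrow> (\<forall>p L d. (\<forall>m. d \<in> local_hull M p L m) \<longrightarrow> d \<in> M p)"

lemma hull_closedD: "hull_closed M \<Longrightarrow> \<forall>m. d \<in> local_hull M p L m \<Longrightarrow> d \<in> M p"
  unfolding hull_closed_def by blast

lemma maximal_dissipative_memI:
  assumes M: "maximal_dissipative M" and le: "\<And>y b. b \<in> M y \<Longrightarrow> (f - b) \<bullet> (p - y) \<le> 0"
  shows "f \<in> M p"
proof -
  obtain l where l: "l > 0" "mran (\<lambda>x. {l *\<^sub>R x - f | f. f \<in> M x}) = UNIV"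
    using M unfolding maximal_dissipative_def by blast
  have "l *\<^sub>R p - f \<in> mran (\<lambda>x. {l *\<^sub>R x - f | f. f \<in> M x})" using l(2) by simp
  then obtain y b where yb: "b \<in> M y" "l *\<^sub>R p - f = l *\<^sub>R y - b" by (auto simp: mran_def)
  then have fb: "f - b = l *\<^sub>R (p - y)" by (simp add: algebra_simps)
  have "l * ((p - y) \<bullet> (p - y)) \<le> 0" using le[OF yb(1)] by (simp add: fb)
  then have "(p - y) \<bullet> (p - y) \<le> 0" using l(1) by (simp add: mult_le_0_iff)
  then have "p = y" by (metis inner_ge_zero inner_eq_zero_iff order_antisym eq_iff_diff_eq_0)
  then show ?thesis using fb yb(1) by simp
qed

lemma maximal_dissipative_imp_dissipative:
  "maximal_dissipative M \<Longrightarrow> dissipative M"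
  unfolding maximal_dissipative_def dissipative_def mdom_def by blast

lemma normal_cone_monotone:
  assumes "n \<in> normal_cone K z" "n' \<in> normal_cone K z'"
  shows "0 \<le> (n - n') \<bullet> (z - z')"
proof -
  have z: "z \<in> K" "z' \<in> K" using assms by (auto simp: normal_cone_def split: if_splits)
  then have "0 \<le> n \<bullet> (z - z')" "0 \<le> n' \<bullet> (z' - z)" using assms by (auto simp: normal_cone_def)
  then show ?thesis by (simp add: inner_diff_left inner_diff_right)
qed

lemma closed_loopD:
  assumes "d \<in> closed_loop A g C K r p"
  obtains a n where "d = (a, r - g p - n)" "a \<in> A p" "n \<in> normal_cone K (snd p)" "p \<in> C \<times> K"
    "d - (0, r) + (0, n) \<in> coupling A g p"
proof -
  have "p \<in> C \<times> K" using assms by (auto simp: closed_loop_def split: if_splits)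
  then obtain a n where "d = (a, r - g p - n)" "a \<in> A p" "n \<in> normal_cone K (snd p)"
    using assms by (auto simp: closed_loop_def)
  then show thesis using that \<open>p \<in> C \<times> K\<close> by (auto simp: coupling_def)
qed

text \<open>The closed loop is the coupling plus a constant minus a normal cone, and the latter is monotone.\<close>

lemma closed_loop_dissipative:
  fixes A :: "'x::real_inner \<times> 'y::real_inner \<Rightarrow> 'x set"
  assumes "maximal_dissipative (coupling A g)"
  shows "dissipative (closed_loop A g C K r)"
  unfolding dissipative_def
proof (intro allI ballI)
  fix p q d e assume d: "d \<in> closed_loop A g C K r p" and e: "e \<in> closed_loop A g C K r q"
  obtain n where n: "n \<in> normal_cone K (snd p)" "d - (0, r) + (0, n) \<in> coupling A g p"
    using d by (rule closed_loopD)
  obtain n' where n': "n' \<in> normal_cone K (snd q)" "e - (0, r) + (0, n') \<in> coupling A g q"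
    using e by (rule closed_loopD)
  have "((d - (0, r) + (0, n)) - (e - (0, r) + (0, n'))) \<bullet> (p - q) \<le> 0"
    using maximal_dissipative_imp_dissipative[OF assms] n(2) n'(2) unfolding dissipative_def by blast
  moreover have "((d - (0, r) + (0, n)) - (e - (0, r) + (0, n'))) \<bullet> (p - q)
      = (d - e) \<bullet> (p - q) + (n - n') \<bullet> (snd p - snd q)"
    by (simp add: inner_prod_def algebra_simps)
  ultimately show "(d - e) \<bullet> (p - q) \<le> 0"
    using normal_cone_monotone[OF n(1) n'(1)] by linarith
qed

lemma nonpos_if_le_small:
  assumes "\<And>m::nat. a \<le> B * inverse (real (Suc m))" shows "a \<le> (0::real)"
proof (rule LIMSEQ_le_const)
  show "(\<lambda>m. B * inverse (real (Suc m))) \<longlonglongrightarrow> 0"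
    using tendsto_mult[OF tendsto_const LIMSEQ_inverse_real_of_nat, of B] by simp
qed (use assms in auto)

text \<open>Since the domain of the coupling is dense in \<open>C \<times> UNIV\<close>, it contains a point \<open>y\<close> whose second component
has a ball of radius \<open>\<rho>\<close> around it inside \<open>K\<close>. Dissipativity against \<open>y\<close> bounds \<open>n \<bullet> (snd q - snd y)\<close>
from above, and the normal cone inequality on that ball bounds it from below by \<open>\<rho> * norm n\<close>.\<close>

lemma normal_part_bounded:
  fixes A :: "'x::real_inner \<times> 'y::real_inner \<Rightarrow> 'x set"
  assumes C: "C \<noteq> {}" and K: "interior K \<noteq> {}" and mdc: "maximal_dissipative_coupling A g C"
  obtains R where "\<And>q e n. norm (q - p) < 1 \<Longrightarrow> norm e \<le> L \<Longrightarrow> n \<in> normal_cone K (snd q) \<Longrightarrow>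
      e - (0, r) + (0, n) \<in> coupling A g q \<Longrightarrow> norm n \<le> R"
proof -
  have max: "maximal_dissipative (coupling A g)" and cl: "closure (mdom (coupling A g)) = C \<times> UNIV"
    using mdc by (auto simp: maximal_dissipative_coupling_def)
  obtain c where "c \<in> C" using C by blast
  obtain u where "u \<in> interior K" using K by blast
  have "open (UNIV \<times> interior K :: ('x \<times> 'y) set)" by (intro open_Times) auto
  moreover have "(c, u) \<in> (UNIV \<times> interior K) \<inter> closure (mdom (coupling A g))"
    using \<open>c \<in> C\<close> \<open>u \<in> interior K\<close> cl by simp
  ultimately have "(UNIV \<times> interior K) \<inter> mdom (coupling A g) \<noteq> {}"
    by (metis empty_iff open_Int_closure_eq_empty)
  then obtain y where y: "snd y \<in> interior K" "y \<in> mdom (coupling A g)" by auto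
  then obtain b where b: "b \<in> coupling A g y" by (auto simp: mdom_def)
  obtain \<rho> where \<rho>: "0 < \<rho>" "cball (snd y) \<rho> \<subseteq> K"
    using y(1) mem_interior_cball by blast
  define R where "R = (\<bar>L\<bar> + norm r + norm b) * (norm p + 1 + norm y) / \<rho>"
  have "norm n \<le> R" if q: "norm (q - p) < 1" and e: "norm e \<le> L" and n: "n \<in> normal_cone K (snd q)"
    and m: "e - (0, r) + (0, n) \<in> coupling A g q" for q e n
  proof -
    have "((e - (0, r) + (0, n)) - b) \<bullet> (q - y) \<le> 0"
      using maximal_dissipative_imp_dissipative[OF max] m b unfolding dissipative_def by blast
    moreover have "((e - (0, r) + (0, n)) - b) \<bullet> (q - y) = (e - (0, r) - b) \<bullet> (q - y) + n \<bullet> (snd q - snd y)"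
      by (simp add: inner_prod_def algebra_simps)
    ultimately have "n \<bullet> (snd q - snd y) \<le> - ((e - (0, r) - b) \<bullet> (q - y))" by linarith
    also have "\<dots> \<le> norm (e - (0, r) - b) * norm (q - y)"
      using Cauchy_Schwarz_ineq2[of "e - (0, r) - b" "q - y"] by linarith
    also have "\<dots> \<le> (\<bar>L\<bar> + norm r + norm b) * (norm p + 1 + norm y)"
    proof (rule mult_mono)
      have "norm (e - (0, r) - b) \<le> norm e + norm ((0::'x), r) + norm b"
        by (meson norm_triangle_ineq4 order_trans add_right_mono)
      then show "norm (e - (0, r) - b) \<le> \<bar>L\<bar> + norm r + norm b" using e by (simp add: norm_Pair)
      have "norm (q - y) \<le> norm (q - p) + (norm p + norm y)"
        using norm_triangle_ineq[of "q - p" "p - y"] norm_triangle_ineq4[of p y] by simp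
      then show "norm (q - y) \<le> norm p + 1 + norm y" using q by linarith
    qed auto
    finally have up: "n \<bullet> (snd q - snd y) \<le> (\<bar>L\<bar> + norm r + norm b) * (norm p + 1 + norm y)" .
    have "snd y + (\<rho> / norm n) *\<^sub>R n \<in> K"
      using \<rho> by (intro subsetD[OF \<rho>(2)]) (auto simp: dist_norm)
    then have "0 \<le> n \<bullet> (snd q - (snd y + (\<rho> / norm n) *\<^sub>R n))"
      using n by (auto simp: normal_cone_def split: if_splits)
    also have "\<dots> = n \<bullet> (snd q - snd y) - \<rho> * norm n"
      by (cases "n = 0") (simp_all add: inner_diff_right inner_add_right power2_norm_eq_inner[symmetric] power2_eq_square)
    finally have "\<rho> * norm n \<le> (\<bar>L\<bar> + norm r + norm b) * (norm p + 1 + norm y)" using up by linarith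
    then show ?thesis using \<rho>(1) by (simp add: R_def pos_le_divide_eq mult.commute)
  qed
  then show thesis using that by blast
qed

text \<open>By the preceding lemma each nearby velocity \<open>e\<close> comes with a normal vector \<open>n\<close> of bounded length. Forming
the convex hulls of the pairs \<open>(e, n)\<close> instead of the velocities, the intersection of nested convex
sets provides a single normal vector belonging to \<open>d\<close>. The defining inequalities of the
coupling at \<open>p\<close> and of the normal cone at \<open>p\<close> are affine in \<open>(e, n)\<close> and hold on the nearby pairs up to
an error of order \<open>1 / m\<close>, so they survive hull, closure and limit; maximality of the coupling turns
the first family back into membership.\<close>

proposition closed_loop_hull_closed:
  fixes A :: "'x::{real_inner, complete_space} \<times> 'y::{real_inner, complete_space} \<Rightarrow> 'x set"
  assumes C: "C \<noteq> {}" "closed C" and K: "closed K" "interior K \<noteq> {}"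
    and mdc: "maximal_dissipative_coupling A g C"
  shows "hull_closed (closed_loop A g C K r)"
  unfolding hull_closed_def
proof (intro allI impI)
  fix p L d assume d: "\<forall>m. d \<in> local_hull (closed_loop A g C K r) p L m"
  have max: "maximal_dissipative (coupling A g)"
    using mdc by (auto simp: maximal_dissipative_coupling_def)
  obtain R where R: "\<And>q e n. norm (q - p) < 1 \<Longrightarrow> norm e \<le> L \<Longrightarrow> n \<in> normal_cone K (snd q) \<Longrightarrow>
      e - (0, r) + (0, n) \<in> coupling A g q \<Longrightarrow> norm n \<le> R"
    using normal_part_bounded[OF C(1) K(2) mdc] by blast
  define S where "S m = {d. \<exists>q. dist q p < inverse (Suc m) \<and> d \<in> closed_loop A g C K r q \<and> norm d \<le> L}" for m :: nat
  define G where "G m = {(e, n). \<exists>q. dist q p < inverse (Suc m) \<and> q \<in> C \<times> K \<and> e - (0, r) + (0, n) \<in> coupling A g q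
      \<and> n \<in> normal_cone K (snd q) \<and> norm e \<le> L \<and> norm n \<le> R}" for m :: nat
  have SG: "S m \<subseteq> fst ` G m" for m
  proof
    fix e assume "e \<in> S m"
    then obtain q where q: "dist q p < inverse (Suc m)" "e \<in> closed_loop A g C K r q" "norm e \<le> L"
      by (auto simp: S_def)
    from q(2) obtain n where n: "n \<in> normal_cone K (snd q)" "q \<in> C \<times> K" "e - (0, r) + (0, n) \<in> coupling A g q"
      by (rule closed_loopD)
    have "inverse (real (Suc m)) \<le> 1" by (simp add: inverse_le_1_iff)
    then have "norm (q - p) < 1" using q(1) unfolding dist_norm by linarith
    then have "norm n \<le> R" using R q(3) n by blast
    then have "(e, n) \<in> G m" unfolding G_def using q n by blast
    then show "e \<in> fst ` G m" by force
  qed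
  have "\<exists>v \<in> convex hull (G m). norm (fst v - d) < inverse (Suc m)" for m
  proof -
    have "d \<in> closure (convex hull (S m))" using d by (simp add: local_hull_def S_def)
    then obtain e where e: "e \<in> convex hull (S m)" "dist e d < inverse (Suc m)"
      unfolding closure_approachable by (meson inverse_positive_iff_positive of_nat_0_less_iff zero_less_Suc)
    have "e \<in> convex hull (fst ` G m)" using e(1) hull_mono[OF SG] by blast
    also have "convex hull (fst ` G m) = fst ` (convex hull (G m))"
      by (rule convex_hull_linear_image[OF linear_fst, symmetric])
    finally show ?thesis using e(2) by (auto simp: dist_norm)
  qed
  then obtain u where u: "\<And>m. u m \<in> convex hull (G m)" "\<And>m. norm (fst (u m) - d) < inverse (Suc m)"
    by metis
  have Gmono: "G k \<subseteq> G m" if "m \<le> k" for m k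
  proof -
    have "inverse (real (Suc k)) \<le> inverse (real (Suc m))" using that by (simp add: le_imp_inverse_le)
    then have "dist q p < inverse (Suc k) \<Longrightarrow> dist q p < inverse (Suc m)" for q by linarith
    then show ?thesis unfolding G_def by blast
  qed
  have "(\<Inter>m. closure (convex hull (u ` {m..}))) \<noteq> {}"
  proof (rule nested_convex_Inter_nonempty)
    fix m
    show "closure (convex hull (u ` {m..})) \<noteq> {}" by (simp add: closure_eq_empty)
    show "closed (closure (convex hull (u ` {m..})))" "convex (closure (convex hull (u ` {m..})))"
      by (simp_all add: convex_closure convex_convex_hull)
    show "closure (convex hull (u ` {Suc m..})) \<subseteq> closure (convex hull (u ` {m..}))"
      by (intro closure_mono hull_mono image_mono) auto
    have "G k \<subseteq> cball 0 (\<bar>L\<bar> + \<bar>R\<bar>)" for k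
    proof
      fix v assume "v \<in> G k"
      then have "norm (fst v) \<le> L" "norm (snd v) \<le> R" by (auto simp: G_def)
      then show "v \<in> cball 0 (\<bar>L\<bar> + \<bar>R\<bar>)"
        using norm_Pair_le[of "fst v" "snd v"] by simp
    qed
    then have "convex hull (G k) \<subseteq> cball 0 (\<bar>L\<bar> + \<bar>R\<bar>)" for k by (intro hull_minimal) auto
    then have "u ` {0..} \<subseteq> cball 0 (\<bar>L\<bar> + \<bar>R\<bar>)" using u(1) by blast
    then have "closure (convex hull (u ` {0..})) \<subseteq> cball 0 (\<bar>L\<bar> + \<bar>R\<bar>)"
      by (intro closure_minimal hull_minimal) auto
    then show "bounded (closure (convex hull (u ` {0..})))" using bounded_subset bounded_cball by blast
  qed
  then obtain v where v: "\<And>m. v \<in> closure (convex hull (u ` {m..}))" by blast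
  have vT: "v \<in> T" if "closed T" "convex T" "\<And>k. m \<le> k \<Longrightarrow> u k \<in> T" for T m
  proof -
    have "closure (convex hull (u ` {m..})) \<subseteq> T"
      using that by (intro closure_minimal hull_minimal) auto
    then show ?thesis using v by blast
  qed
  have vG: "v \<in> T" if T: "closed T" "convex T" "G m \<subseteq> T" for T m
  proof (rule vT[OF T(1,2)])
    fix k assume "m \<le> k"
    then have "convex hull (G k) \<subseteq> T" using Gmono T(2,3) by (intro hull_minimal) blast+
    then show "u k \<in> T" using u(1) by blast
  qed
  have "norm (fst v - d) \<le> 1 * inverse (real (Suc m))" for m
  proof -
    have "v \<in> cball d (inverse (real (Suc m))) \<times> UNIV"
    proof (rule vT[where m = m])
      fix k assume "m \<le> k"
      then have "inverse (real (Suc k)) \<le> inverse (real (Suc m))" by (simp add: le_imp_inverse_le)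
      then have "norm (fst (u k) - d) \<le> inverse (real (Suc m))" using u(2)[of k] by linarith
      then show "u k \<in> cball d (inverse (real (Suc m))) \<times> UNIV"
        by (auto simp: mem_Times_iff dist_norm norm_minus_commute)
    qed (auto intro: closed_Times convex_Times)
    then show ?thesis by (auto simp: mem_Times_iff dist_norm norm_minus_commute)
  qed
  then have "norm (fst v - d) \<le> 0" by (rule nonpos_if_le_small)
  then have fv: "fst v = d" by simp
  define n where "n = snd v"
  have vdn: "v = (d, n)" using fv n_def by (metis prod.collapse)
  have p: "p \<in> C \<times> K"
  proof -
    have "\<exists>q\<in>C \<times> K. dist q p < e" if "0 < e" for e
    proof -
      obtain m where m: "inverse (real (Suc m)) < e" using reals_Archimedean[OF \<open>0 < e\<close>] by blast
      have "G m \<noteq> {}" using u(1)[of m] by auto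
      then show ?thesis unfolding G_def using m less_trans by fastforce
    qed
    then have "p \<in> closure (C \<times> K)" by (simp add: closure_approachable)
    then show ?thesis using closed_Times[OF C(2) K(1)] by simp
  qed
  have f: "d - (0, r) + (0, n) \<in> coupling A g p"
  proof (rule maximal_dissipative_memI[OF max])
    fix y b assume b: "b \<in> coupling A g y"
    define w where "w = p - y"
    define B where "B = \<bar>L\<bar> + norm r + \<bar>R\<bar> + norm b"
    have half: "((fst h - (0, r) + (0, snd h) - b) \<bullet> w \<le> c) = ((w, snd w) \<bullet> h \<le> c + ((0, r) + b) \<bullet> w)" for h c
      by (simp add: inner_prod_def algebra_simps inner_commute)
    have "(d - (0, r) + (0, n) - b) \<bullet> w \<le> B * inverse (real (Suc m))" for m
    proof -
      let ?T = "{h. (w, snd w) \<bullet> h \<le> B * inverse (real (Suc m)) + ((0, r) + b) \<bullet> w}"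
      have "G m \<subseteq> ?T"
      proof
        fix h assume "h \<in> G m"
        then obtain e k q where h: "h = (e, k)" and q: "dist q p < inverse (Suc m)" "q \<in> C \<times> K"
          "e - (0, r) + (0, k) \<in> coupling A g q" "norm e \<le> L" "norm k \<le> R"
          by (auto simp: G_def)
        let ?f = "e - (0, r) + (0, k) - b"
        have "?f \<bullet> (q - y) \<le> 0"
          using maximal_dissipative_imp_dissipative[OF max] q(3) b unfolding dissipative_def by blast
        moreover have "?f \<bullet> w = ?f \<bullet> (q - y) + ?f \<bullet> (p - q)" by (simp add: w_def inner_diff_right)
        ultimately have "?f \<bullet> w \<le> norm ?f * norm (p - q)"
          using norm_cauchy_schwarz[of ?f "p - q"] by linarith
        also have "\<dots> \<le> B * inverse (Suc m)"
        proof (rule mult_mono)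
          have "norm ?f \<le> norm e + norm ((0::'x), r) + norm ((0::'x), k) + norm b"
            by (meson norm_triangle_ineq norm_triangle_ineq4 order_trans add_right_mono)
          then show "norm ?f \<le> B" using q(4,5) by (simp add: B_def norm_Pair)
          show "norm (p - q) \<le> inverse (Suc m)" using q(1) by (simp add: dist_norm norm_minus_commute)
        qed (auto simp: B_def)
        finally show "h \<in> ?T" using half[of h] by (simp add: h)
      qed
      then have "v \<in> ?T" by (intro vG[of ?T m]) (auto simp: closed_halfspace_le convex_halfspace_le)
      then show ?thesis using half[of v] by (simp add: vdn)
    qed
    then show "(d - (0, r) + (0, n) - b) \<bullet> (p - y) \<le> 0"
      unfolding w_def by (rule nonpos_if_le_small)
  qed
  have nc: "n \<in> normal_cone K (snd p)"
  proof -
    have "0 \<le> n \<bullet> (snd p - y)" if y: "y \<in> K" for y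
    proof -
      have "- (n \<bullet> (snd p - y)) \<le> \<bar>R\<bar> * inverse (real (Suc m))" for m
      proof -
        let ?T = "{h. (0, y - snd p) \<bullet> h \<le> \<bar>R\<bar> * inverse (real (Suc m))}"
        have "G m \<subseteq> ?T"
        proof
          fix h assume "h \<in> G m"
          then obtain e k q where h: "h = (e, k)" and q: "dist q p < inverse (Suc m)"
            "k \<in> normal_cone K (snd q)" "norm k \<le> R"
            by (auto simp: G_def)
          have "0 \<le> k \<bullet> (snd q - y)" using q(2) y by (auto simp: normal_cone_def split: if_splits)
          then have "(y - snd p) \<bullet> k \<le> k \<bullet> (snd q - snd p)"
            by (simp add: inner_diff_right inner_diff_left inner_commute)
          also have "\<dots> \<le> norm k * norm (snd q - snd p)" by (rule norm_cauchy_schwarz)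
          also have "\<dots> \<le> \<bar>R\<bar> * inverse (Suc m)"
          proof (rule mult_mono)
            have "norm (snd q - snd p) \<le> dist q p" using dist_snd_le[of q p] by (simp add: dist_norm)
            then show "norm (snd q - snd p) \<le> inverse (Suc m)" using q(1) by linarith
          qed (use q(3) in auto)
          finally show "h \<in> ?T" by (simp add: h inner_prod_def)
        qed
        then have "v \<in> ?T" by (intro vG[of ?T m]) (auto simp: closed_halfspace_le convex_halfspace_le)
        then show ?thesis by (simp add: vdn inner_diff_right inner_diff_left inner_commute)
      qed
      then have "- (n \<bullet> (snd p - y)) \<le> 0" by (rule nonpos_if_le_small)
      then show ?thesis by simp
    qed
    then show ?thesis using p by (auto simp: normal_cone_def)
  qed
  obtain a b where "d = (a, b)" by (cases d)
  then show "d \<in> closed_loop A g C K r p"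
    using f nc p by (auto simp: coupling_def closed_loop_def mem_Times_iff algebra_simps intro!: exI[of _ n])
qed

section \<open>Limits of solutions\<close>

lemma vector_derivative_lipschitz_bound:
  fixes w :: "real \<Rightarrow> 'h::real_normed_vector"
  assumes lip: "\<And>s t. 0 \<le> s \<Longrightarrow> 0 \<le> t \<Longrightarrow> norm (w t - w s) \<le> L * \<bar>t - s\<bar>"
    and t: "0 \<le> t" and d: "(w has_vector_derivative d) (at t)"
  shows "norm d \<le> L"
proof (rule field_le_epsilon)
  fix e :: real assume e: "0 < e"
  obtain \<delta> where \<delta>: "0 < \<delta>" "\<And>y. norm (y - t) < \<delta> \<Longrightarrow> norm (w y - w t - (y - t) *\<^sub>R d) \<le> e * norm (y - t)"
    using d[unfolded has_vector_derivative_def has_derivative_at_alt] e by blast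
  define h where "h = \<delta> / 2"
  have h: "0 < h" "h < \<delta>" using \<delta>(1) by (auto simp: h_def)
  have "norm (w (t + h) - w t - h *\<^sub>R d) \<le> e * h" using \<delta>(2)[of "t + h"] h by simp
  moreover have "norm (w (t + h) - w t) \<le> L * h" using lip[of t "t + h"] t h by simp
  ultimately have "norm (h *\<^sub>R d) \<le> (L + e) * h"
    using norm_triangle_ineq2[of "h *\<^sub>R d" "w (t + h) - w t"]
    by (simp add: norm_minus_commute distrib_right)
  then show "norm d \<le> L + e" using h by (simp add: mult.commute)
qed

text \<open>The difference quotients of \<open>W k\<close> are means of velocities, hence lie in the local hulls at \<open>w t\<close> once
\<open>k\<close> is large and the step is small; so do their limits, the difference quotients of \<open>w\<close>. Therefore the
derivative of \<open>w\<close>, wherever it exists, belongs to \<open>M (w t)\<close>. Where it does not exist, the local hulls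
are still nonempty and their intersection shows that \<open>w t\<close> is in the domain.\<close>

proposition lipschitz_limit_strong_solution:
  fixes W :: "nat \<Rightarrow> real \<Rightarrow> 'h::{real_inner, complete_space}"
  assumes hc: "hull_closed M"
    and lip: "\<And>k s t. 0 \<le> s \<Longrightarrow> 0 \<le> t \<Longrightarrow> norm (W k t - W k s) \<le> L * \<bar>t - s\<bar>"
    and traj: "\<And>k. trajectory M (W k)"
    and lim: "\<And>t. 0 \<le> t \<Longrightarrow> (\<lambda>k. W k t) \<longlonglongrightarrow> w t"
  shows "strong_solution M w"
    and "\<And>s t. 0 \<le> s \<Longrightarrow> 0 \<le> t \<Longrightarrow> norm (w t - w s) \<le> L * \<bar>t - s\<bar>"
proof -
  have L0: "0 \<le> L" using order_trans[OF norm_ge_zero lip[of 0 1]] by simp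
  show wlip: "norm (w t - w s) \<le> L * \<bar>t - s\<bar>" if "0 \<le> s" "0 \<le> t" for s t
    by (rule LIMSEQ_le_const2[OF tendsto_norm[OF tendsto_diff[OF lim lim]]])
       (use that lip in auto)
  have avg: "\<exists>\<delta>>0. \<forall>h. 0 < h \<longrightarrow> h \<le> \<delta> \<longrightarrow> (w (t + h) - w t) /\<^sub>R h \<in> local_hull M (w t) L m"
    if t: "0 \<le> t" for t m
  proof -
    define \<eta> where "\<eta> = inverse (real (Suc m))"
    have \<eta>: "0 < \<eta>" by (simp add: \<eta>_def)
    define \<delta> where "\<delta> = \<eta> / (2 * (L + 1))"
    have \<delta>: "0 < \<delta>" using \<eta> L0 by (simp add: \<delta>_def)
    have L\<delta>: "L * \<delta> \<le> \<eta> / 2" using \<eta> L0 by (simp add: \<delta>_def field_simps)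
    obtain k0 where k0: "\<And>k. k0 \<le> k \<Longrightarrow> norm (W k t - w t) < \<eta> / 2"
      using LIMSEQ_D[OF lim[OF t], of "\<eta>/2"] \<eta> by auto
    have "(w (t + h) - w t) /\<^sub>R h \<in> local_hull M (w t) L m" if h: "0 < h" "h \<le> \<delta>" for h
    proof -
      have "(W (k + k0) (t + h) - W (k + k0) t) /\<^sub>R h \<in> local_hull M (w t) L m" for k
      proof -
        let ?k = "k + k0"
        obtain N where N: "negligible N"
          "\<And>s. 0 < s \<Longrightarrow> s \<notin> N \<Longrightarrow> \<exists>d\<in>M (W ?k s). (W ?k has_vector_derivative d) (at s)"
          using traj[of ?k] unfolding trajectory_def by blast
        define f where "f s = vector_derivative (W ?k) (at s)" for s
        have f: "f s \<in> M (W ?k s)" "(W ?k has_vector_derivative f s) (at s)" if "0 < s" "s \<notin> N" for s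
          using N(2)[OF that] by (auto simp: f_def vector_derivative_at)
        have negN: "negligible (N \<union> {t})" using N(1) by simp
        have "(f has_integral (W ?k (t + h) - W ?k t)) {t..t + h}"
        proof (rule fundamental_theorem_dominated[OF _ negN, of _ _ "\<lambda>_. L"])
          show "(\<lambda>_. L) integrable_on {t..t + h}" by (rule integrable_const_ivl)
          show "norm (W ?k v - W ?k u) \<le> integral {u..v} (\<lambda>_. L)" if "t \<le> u" "u \<le> v" for u v
            using lip[of u v ?k] that t by (simp add: mult.commute)
          show "(W ?k has_vector_derivative f s) (at s within {t..t + h})" if "s \<in> {t..t + h} - (N \<union> {t})" for s
            using f(2)[of s] that t by (auto intro: has_vector_derivative_at_within)
        qed (use h in simp)
        then have "(W ?k (t + h) - W ?k t) /\<^sub>R (t + h - t) \<in> local_hull M (w t) L m"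
        proof (rule has_integral_mean_in_convex[OF _ _ negN])
          show "closed (local_hull M (w t) L m)" "convex (local_hull M (w t) L m)"
            by (simp_all add: local_hull_def convex_closure convex_convex_hull)
          fix s assume s: "s \<in> {t..t + h} - (N \<union> {t})"
          then have s0: "0 < s" "s \<notin> N" "t \<le> s" "s - t \<le> \<delta>" using t h by auto
          have "norm (f s) \<le> L"
            using vector_derivative_lipschitz_bound[OF lip _ f(2)[OF s0(1,2)]] s0(1) by simp
          moreover have "dist (W ?k s) (w t) < inverse (Suc m)"
          proof -
            have "norm (W ?k s - W ?k t) \<le> L * (s - t)" using lip[of t s ?k] t s0 by simp
            also have "\<dots> \<le> \<eta> / 2" using mult_left_mono[OF s0(4) L0] L\<delta> by linarith
            finally have "norm (W ?k s - w t) < \<eta>"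
              using k0[of ?k] norm_triangle_ineq[of "W ?k s - W ?k t" "W ?k t - w t"] by simp
            then show ?thesis by (simp add: dist_norm \<eta>_def)
          qed
          ultimately have "f s \<in> {d. \<exists>q. dist q (w t) < inverse (Suc m) \<and> d \<in> M q \<and> norm d \<le> L}"
            using f(1)[OF s0(1,2)] by blast
          then show "f s \<in> local_hull M (w t) L m"
            unfolding local_hull_def by (meson closure_subset hull_subset subsetD)
        qed (use h in simp)
        then show ?thesis by simp
      qed
      note quot = this
      have lm: "(\<lambda>k. (W (k + k0) (t + h) - W (k + k0) t) /\<^sub>R h) \<longlonglongrightarrow> (w (t + h) - w t) /\<^sub>R h"
        using t h by (intro tendsto_intros LIMSEQ_ignore_initial_segment lim) auto
      have "closed (local_hull M (w t) L m)" by (simp add: local_hull_def)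
      then show ?thesis by (rule closed_sequentially[OF _ quot lm])
    qed
    then show ?thesis using \<delta> by blast
  qed
  have derM: "v \<in> M (w t)" if t: "0 < t" and v: "(w has_vector_derivative v) (at t)" for t v
  proof -
    have "\<forall>m. v \<in> local_hull M (w t) L m"
    proof
      fix m
      obtain \<delta> where \<delta>: "0 < \<delta>" "\<And>h. 0 < h \<Longrightarrow> h \<le> \<delta> \<Longrightarrow> (w (t + h) - w t) /\<^sub>R h \<in> local_hull M (w t) L m"
        using avg[of t m] t by auto
      have "v \<in> closure (local_hull M (w t) L m)"
        unfolding closure_approachable
      proof (intro allI impI)
        fix e :: real assume e: "0 < e"
        then obtain d where d: "0 < d" "\<And>y. norm (y - t) < d \<Longrightarrow> norm (w y - w t - (y - t) *\<^sub>R v) \<le> e / 2 * norm (y - t)"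
          using v[unfolded has_vector_derivative_def has_derivative_at_alt] by (meson half_gt_zero)
        define h where "h = min \<delta> (d / 2)"
        have h: "0 < h" "h \<le> \<delta>" "h < d" using \<delta>(1) d(1) by (auto simp: h_def)
        have "(w (t + h) - w t) /\<^sub>R h - v = (w (t + h) - w t - h *\<^sub>R v) /\<^sub>R h"
          using h(1) by (simp add: scaleR_diff_right)
        then have "norm ((w (t + h) - w t) /\<^sub>R h - v) = norm (w (t + h) - w t - h *\<^sub>R v) / h"
          using h(1) by (simp add: divide_inverse mult.commute)
        also have "\<dots> \<le> e / 2" using d(2)[of "t + h"] h by (simp add: divide_le_eq)
        also have "\<dots> < e" using e by simp
        finally show "\<exists>y\<in>local_hull M (w t) L m. dist y v < e" using \<delta>(2)[OF h(1,2)] by (auto simp: dist_norm)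
      qed
      then show "v \<in> local_hull M (w t) L m" by (simp add: local_hull_def)
    qed
    then show ?thesis by (rule hull_closedD[OF hc])
  qed
  have dom: "w t \<in> mdom M" if t: "0 \<le> t" for t
  proof -
    have "(\<Inter>m. local_hull M (w t) L m) \<noteq> {}"
    proof (rule nested_convex_Inter_nonempty)
      fix m
      obtain \<delta> where "0 < \<delta>" "\<And>h. 0 < h \<Longrightarrow> h \<le> \<delta> \<Longrightarrow> (w (t + h) - w t) /\<^sub>R h \<in> local_hull M (w t) L m"
        using avg[OF t, of m] by auto
      from this(2)[OF this(1) order_refl] show "local_hull M (w t) L m \<noteq> {}" by blast
      show "closed (local_hull M (w t) L m)" "convex (local_hull M (w t) L m)"
        by (simp_all add: local_hull_def convex_closure convex_convex_hull)
      have "inverse (real (Suc (Suc m))) \<le> inverse (real (Suc m))" by simp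
      then have "dist q (w t) < inverse (Suc (Suc m)) \<Longrightarrow> dist q (w t) < inverse (Suc m)" for q by linarith
      then show "local_hull M (w t) L (Suc m) \<subseteq> local_hull M (w t) L m"
        unfolding local_hull_def by (intro closure_mono hull_mono) blast
      have "local_hull M (w t) L 0 \<subseteq> cball 0 L"
        unfolding local_hull_def by (intro closure_minimal hull_minimal) auto
      then show "bounded (local_hull M (w t) L 0)" using bounded_subset bounded_cball by blast
    qed
    then obtain d where "\<forall>m. d \<in> local_hull M (w t) L m" by blast
    then have "d \<in> M (w t)" by (rule hull_closedD[OF hc])
    then show ?thesis by (auto simp: mdom_def)
  qed
  obtain N where N: "negligible N" "\<And>t. 0 < t \<Longrightarrow> t \<notin> N \<Longrightarrow> \<exists>v. (w has_vector_derivative v) (at t)"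
    using lipschitz_abs_continuous(2)[OF wlip] by blast
  show "strong_solution M w"
    unfolding strong_solution_def AE_lebesgue_iff_negligible
  proof (intro conjI allI impI exI[of _ N])
    fix t assume "t \<notin> N" "0 < t"
    then obtain v where "(w has_vector_derivative v) (at t)" using N(2) by blast
    then show "\<exists>d\<in>M (w t). (w has_vector_derivative d) (at t)" using derM \<open>0 < t\<close> by blast
  qed (use lipschitz_abs_continuous(1)[OF wlip] dom N(1) in simp_all)
qed

text \<open>If \<open>V (r k)\<close> converges then, by contraction, so do the shifted trajectories at every later time.\<close>

proposition omega_limit_solution:
  fixes V :: "real \<Rightarrow> 'h::{real_inner, complete_space}"
  assumes hc: "hull_closed M" and M: "dissipative M" and V: "trajectory M V"
    and lip: "\<And>s t. 0 \<le> s \<Longrightarrow> 0 \<le> t \<Longrightarrow> norm (V t - V s) \<le> L * \<bar>t - s\<bar>"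
    and S: "compact S" "\<And>t. 0 \<le> t \<Longrightarrow> V t \<in> S"
  obtains r W where "strict_mono (r :: nat \<Rightarrow> nat)" "strong_solution M W"
    "\<And>t. 0 \<le> t \<Longrightarrow> (\<lambda>k. V (t + real (r k))) \<longlonglongrightarrow> W t"
    "\<And>s t. 0 \<le> s \<Longrightarrow> 0 \<le> t \<Longrightarrow> norm (W t - W s) \<le> L * \<bar>t - s\<bar>"
    "\<And>t. 0 \<le> t \<Longrightarrow> W t \<in> S"
proof -
  have "seq_compact S" using S(1) compact_imp_seq_compact by blast
  then obtain l r where r: "strict_mono (r :: nat \<Rightarrow> nat)" and l: "((\<lambda>n. V (real n)) \<circ> r) \<longlonglongrightarrow> l"
    using S(2) unfolding seq_compact_def by (metis of_nat_0_le_iff)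
  have C0: "Cauchy (\<lambda>k. V (real (r k)))" using LIMSEQ_imp_Cauchy[OF l] by (simp add: o_def)
  define W where "W t = lim (\<lambda>k. V (t + real (r k)))" for t
  have lim: "(\<lambda>k. V (t + real (r k))) \<longlonglongrightarrow> W t" if t: "0 \<le> t" for t
  proof -
    have "Cauchy (\<lambda>k. V (t + real (r k)))"
    proof (rule metric_CauchyI)
      fix e :: real assume "0 < e"
      then obtain K where K: "\<And>m n. K \<le> m \<Longrightarrow> K \<le> n \<Longrightarrow> dist (V (real (r m))) (V (real (r n))) < e"
        using metric_CauchyD[OF C0] by blast
      have "dist (V (t + real (r m))) (V (t + real (r n))) \<le> dist (V (real (r m))) (V (real (r n)))" for m n
        using dissipative_contraction[OF M trajectory_shift[OF V] trajectory_shift[OF V], of "real (r m)" "real (r n)" 0 t] t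
        by (simp add: dist_norm)
      then show "\<exists>K. \<forall>m\<ge>K. \<forall>n\<ge>K. dist (V (t + real (r m))) (V (t + real (r n))) < e"
        using K by (meson le_less_trans)
    qed
    then show ?thesis unfolding W_def using Cauchy_convergent convergent_LIMSEQ_iff by blast
  qed
  have lip': "norm (V (t + real (r k)) - V (s + real (r k))) \<le> L * \<bar>t - s\<bar>" if "0 \<le> s" "0 \<le> t" for k s t
    using lip[of "s + real (r k)" "t + real (r k)"] that by simp
  have traj': "trajectory M (\<lambda>t. V (t + real (r k)))" for k by (rule trajectory_shift[OF V]) simp
  have "W t \<in> S" if "0 \<le> t" for t
    by (rule closed_sequentially[OF compact_imp_closed[OF S(1)] _ lim[OF that]]) (simp add: S(2) that)
  then show thesis
    using that[OF r] lipschitz_limit_strong_solution[OF hc lip' traj' lim] lim by blast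
qed

text \<open>The distance of \<open>V\<close> to an equilibrium decreases, so along the \<open>\<omega>\<close>-limit it has reached its limit.\<close>

lemma omega_limit_distance_const:
  fixes V :: "real \<Rightarrow> 'h::real_inner"
  assumes M: "dissipative M" and V: "trajectory M V" and p: "trajectory M (\<lambda>_. p)"
    and r: "strict_mono (r :: nat \<Rightarrow> nat)"
    and lim: "\<And>t. 0 \<le> t \<Longrightarrow> (\<lambda>k. V (t + real (r k))) \<longlonglongrightarrow> W t"
    and t: "0 \<le> t"
  shows "norm (W t - p) = norm (W 0 - p)"
proof (rule antisym)
  have mono: "norm (V b - p) \<le> norm (V a - p)" if "0 \<le> a" "a \<le> b" for a b
    using dissipative_contraction[OF M V p that] .
  have lt: "(\<lambda>k. norm (V (t + real (r k)) - p)) \<longlonglongrightarrow> norm (W t - p)" if "0 \<le> t" for t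
    by (intro tendsto_intros lim that)
  show "norm (W t - p) \<le> norm (W 0 - p)"
    by (rule LIMSEQ_le[OF lt[OF t] lt[of 0]]) (use t mono in auto)
  have "norm (W 0 - p) \<le> norm (V (t + real (r k)) - p)" for k
  proof (rule LIMSEQ_le_const2[OF lt[of 0]])
    obtain n where n: "t + real (r k) \<le> real n" using real_arch_simple by blast
    have "norm (V (0 + real (r j)) - p) \<le> norm (V (t + real (r k)) - p)" if "n \<le> j" for j
    proof -
      have "real n \<le> real (r j)" using seq_suble[OF r, of j] that by simp
      then show ?thesis using n t by (intro mono) auto
    qed
    then show "\<exists>N. \<forall>j\<ge>N. norm (V (0 + real (r j)) - p) \<le> norm (V (t + real (r k)) - p)" by blast
  qed simp
  then show "norm (W 0 - p) \<le> norm (W t - p)"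
    by (intro LIMSEQ_le_const[OF lt[OF t]]) auto
qed

section \<open>Asymptotics of the closed loop\<close>

text \<open>An orthogonal spanning set turns the ball into a closed subset of a finite sum of compact segments.\<close>

lemma compact_cball_finite_span:
  fixes B :: "'y::real_inner set"
  assumes B: "finite B" "span B = UNIV"
  shows "compact (cball (0::'y) R)"
proof -
  obtain C :: "'y set" where C: "finite C" "span C = UNIV" "pairwise orthogonal C"
    using basis_orthogonal[OF B(1)] B(2) by metis
  define T where "T E = {(\<Sum>c\<in>E. a c *\<^sub>R c) | a. \<forall>c\<in>E. \<bar>a c * norm c\<bar> \<le> R \<and> (c = 0 \<longrightarrow> a c = 0)}" for E :: "'y set"
  have comp: "compact (T E)" if "finite E" for E using that
  proof (induction E rule: finite_induct)
    case empty
    have "T {} = {0}" by (auto simp: T_def)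
    then show ?case by simp
  next
    case (insert b E)
    define I where "I = {\<alpha>::real. \<bar>\<alpha> * norm b\<bar> \<le> R \<and> (b = 0 \<longrightarrow> \<alpha> = 0)}"
    have "compact I"
    proof (cases "b = 0")
      case True
      then have "I \<subseteq> {0}" by (auto simp: I_def)
      then show ?thesis using finite_subset finite_imp_compact by blast
    next
      case False
      then have "I = {- (R / norm b)..R / norm b}" by (auto simp: I_def abs_le_iff field_simps)
      then show ?thesis by simp
    qed
    then have 1: "compact ((\<lambda>\<alpha>. \<alpha> *\<^sub>R b) ` I)"
      by (intro compact_continuous_image continuous_intros)
    have "T (insert b E) = {x + y | x y. x \<in> (\<lambda>\<alpha>. \<alpha> *\<^sub>R b) ` I \<and> y \<in> T E}" (is "_ = ?R")
    proof
      show "T (insert b E) \<subseteq> ?R" using insert(1,2) by (fastforce simp: T_def I_def)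
      show "?R \<subseteq> T (insert b E)"
      proof
        fix v assume "v \<in> ?R"
        then obtain \<alpha> a where "\<alpha> \<in> I" "\<forall>c\<in>E. \<bar>a c * norm c\<bar> \<le> R \<and> (c = 0 \<longrightarrow> a c = 0)"
          "v = \<alpha> *\<^sub>R b + (\<Sum>c\<in>E. a c *\<^sub>R c)" by (auto simp: T_def)
        moreover have "(\<Sum>c\<in>E. (if c = b then \<alpha> else a c) *\<^sub>R c) = (\<Sum>c\<in>E. a c *\<^sub>R c)"
          using insert(2) by (intro sum.cong) auto
        ultimately show "v \<in> T (insert b E)"
          using insert(1,2) unfolding T_def I_def
          by (intro CollectI exI[of _ "\<lambda>c. if c = b then \<alpha> else a c"]) auto
      qed
    qed
    then show ?case using compact_sums[OF 1 insert(3)] by (simp only:)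
  qed
  have "cball 0 R \<subseteq> T C"
  proof
    fix y :: 'y assume y: "y \<in> cball 0 R"
    define a where "a c = (if c = 0 then 0 else (y \<bullet> c) / (c \<bullet> c))" for c :: 'y
    define z where "z = y - (\<Sum>c\<in>C. a c *\<^sub>R c)"
    have "orthogonal z c" if "c \<in> C" for c
    proof -
      have "(\<Sum>b\<in>C. a b *\<^sub>R b) \<bullet> c = (\<Sum>b\<in>C. a b * (b \<bullet> c))" by (simp add: inner_sum_left)
      also have "\<dots> = (\<Sum>b\<in>C. if b = c then a c * (c \<bullet> c) else 0)"
        using C(3) that by (intro sum.cong) (auto simp: pairwise_def orthogonal_def)
      also have "\<dots> = a c * (c \<bullet> c)" using C(1) that by simp
      also have "\<dots> = y \<bullet> c" by (auto simp: a_def)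
      finally show ?thesis by (simp add: z_def orthogonal_def inner_diff_left)
    qed
    then have "orthogonal z z" using orthogonal_to_span[of z C z] C(2) by (metis UNIV_I orthogonal_commute)
    then have "y = (\<Sum>c\<in>C. a c *\<^sub>R c)" by (simp add: z_def orthogonal_self)
    moreover have "\<bar>a c * norm c\<bar> \<le> R" for c
    proof (cases "c = 0")
      case True
      have "0 \<le> R" using y norm_ge_zero[of y] by (simp del: norm_ge_zero)
      then show ?thesis using True by simp
    next
      case False
      then have "\<bar>a c * norm c\<bar> = \<bar>y \<bullet> c\<bar> / norm c"
        by (simp add: a_def abs_mult power2_norm_eq_inner[symmetric] power2_eq_square)
      also have "\<dots> \<le> norm y" using False Cauchy_Schwarz_ineq2[of y c] by (simp add: divide_le_eq)
      finally show ?thesis using y by simp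
    qed
    ultimately show "y \<in> T C" unfolding T_def by (auto simp: a_def)
  qed
  then have "cball 0 R = T C \<inter> cball 0 R" by blast
  then show ?thesis using compact_Int_closed[OF comp[OF C(1)] closed_cball] by metis
qed

lemma trajectory_continuous_on:
  fixes w :: "real \<Rightarrow> 'h::real_normed_vector"
  assumes w: "trajectory M w"
  shows "continuous_on {0..} w"
  unfolding continuous_on_iff
proof (intro ballI allI impI)
  fix t e :: real assume t: "t \<in> {0..}" and e: "0 < e"
  then have "0 \<le> t + 1" by simp
  then obtain g where g: "g integrable_on {0..t + 1}"
    "\<And>p q. 0 \<le> p \<Longrightarrow> p \<le> q \<Longrightarrow> q \<le> t + 1 \<Longrightarrow> norm (w q - w p) \<le> integral {p..q} g"
    using w unfolding trajectory_def by meson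
  define G where "G s = integral {0..s} g" for s
  have "continuous_on {0..t + 1} G" unfolding G_def by (rule indefinite_integral_continuous_1[OF g(1)])
  then obtain d where d: "0 < d" "\<And>s. s \<in> {0..t + 1} \<Longrightarrow> dist s t < d \<Longrightarrow> dist (G s) (G t) < e"
    unfolding continuous_on_iff using t e by (metis add_increasing2 atLeastAtMost_iff atLeast_iff le_add_same_cancel1 zero_le_one)
  have inc: "norm (w q - w p) \<le> G q - G p" if "0 \<le> p" "p \<le> q" "q \<le> t + 1" for p q
  proof -
    have "g integrable_on {0..q}" by (rule integrable_subinterval_real[OF g(1)]) (use that in auto)
    from Henstock_Kurzweil_Integration.integral_combine[OF that(1,2) this] g(2)[OF that] show ?thesis by (simp add: G_def)
  qed
  have "dist (w s) (w t) < e" if s: "s \<in> {0..}" "dist s t < min d 1" for s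
  proof -
    have s1: "s \<in> {0..t + 1}" using s by (auto simp: dist_real_def)
    have "dist (w s) (w t) \<le> \<bar>G s - G t\<bar>"
    proof (cases "s \<le> t")
      case True
      then show ?thesis using inc[of s t] s t by (simp add: dist_norm norm_minus_commute)
    next
      case False
      then show ?thesis using inc[of t s] s1 t by (simp add: dist_norm)
    qed
    also have "\<dots> < e" using d(2)[OF s1] s by (simp add: dist_real_def)
    finally show ?thesis .
  qed
  then show "\<exists>d>0. \<forall>s\<in>{0..}. dist s t < d \<longrightarrow> dist (w s) (w t) < e"
    using d(1) by (intro exI[of _ "min d 1"]) auto
qed

text \<open>The dissipation of the squared distance to the equilibrium splits into the supply term \<open>h\<close> and the
normal cone term, both nonnegative. When the distance is constant their sum vanishes, hence so
does each of them.\<close>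

lemma limit_solution_h_zero:
  fixes A :: "'x::real_inner \<times> 'y::real_inner \<Rightarrow> 'x set"
  assumes max: "maximal_dissipative (coupling A g)"
    and W: "trajectory (closed_loop A g C K r) W"
    and P: "0 \<in> closed_loop A g C K r (xs, us)"
    and const: "\<And>t. 0 \<le> t \<Longrightarrow> norm (W t - (xs, us)) = norm (W 0 - (xs, us))"
  shows "AE t in lebesgue. t > 0 \<longrightarrow> h_fun g (\<lambda>t. fst (W t)) (\<lambda>t. snd (W t)) (\<lambda>_. xs) (\<lambda>_. us) t = 0"
proof -
  define P where "P = (xs, us)"
  obtain N where N: "negligible N"
    "\<And>t. 0 < t \<Longrightarrow> t \<notin> N \<Longrightarrow> \<exists>d\<in>closed_loop A g C K r (W t). (W has_vector_derivative d) (at t)"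
    using W unfolding trajectory_def by blast
  obtain n' where n': "(0::'x \<times> 'y) = (0, r - g P - n')" "n' \<in> normal_cone K us" "0 \<in> A P"
    using P unfolding P_def[symmetric] by (rule closed_loopD) (auto simp: P_def zero_prod_def)
  have gP: "r = g P + n'" using n'(1) by (simp add: zero_prod_def algebra_simps)
  have "h_fun g (\<lambda>t. fst (W t)) (\<lambda>t. snd (W t)) (\<lambda>_. xs) (\<lambda>_. us) t = 0" if t: "0 < t" "t \<notin> N" for t
  proof -
    obtain d where d: "d \<in> closed_loop A g C K r (W t)" and der: "(W has_vector_derivative d) (at t)"
      using N(2)[OF t] by blast
    from d obtain a n where an: "d = (a, r - g (W t) - n)" "a \<in> A (W t)" "n \<in> normal_cone K (snd (W t))"
      by (rule closed_loopD)
    have sq: "((\<lambda>s. (norm (u s - c))\<^sup>2) has_real_derivative 2 * (e \<bullet> (u t - c))) (at t)"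
      if "(u has_vector_derivative e) (at t)" for u :: "real \<Rightarrow> 'h::real_inner" and c e
    proof -
      have "((\<lambda>s. u s - c) has_derivative (\<lambda>h. h *\<^sub>R e)) (at t)"
        using that by (auto simp: has_vector_derivative_def intro!: derivative_eq_intros)
      from has_derivative_inner[OF this this]
      have "((\<lambda>s. (u s - c) \<bullet> (u s - c)) has_derivative (\<lambda>h. 2 * (e \<bullet> (u t - c)) * h)) (at t)"
        by (rule has_derivative_eq_rhs) (auto simp: inner_commute)
      then show ?thesis by (simp add: has_field_derivative_def power2_norm_eq_inner)
    qed
    have "((\<lambda>s. (norm (W s - P))\<^sup>2) has_real_derivative 0) (at t)"
    proof (rule has_field_derivative_transform_within_open[of "\<lambda>_. (norm (W 0 - P))\<^sup>2" 0 t "{0<..}"])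
      show "(norm (W 0 - P))\<^sup>2 = (norm (W s - P))\<^sup>2" if "s \<in> {0<..}" for s
        using const[of s] that by (simp add: P_def)
    qed (use t in auto)
    from DERIV_unique[OF sq[OF der, of P] this] have dP: "d \<bullet> (W t - P) = 0" by simp
    have "(fst d \<bullet> (fst (W t) - xs) + snd d \<bullet> (snd (W t) - us)) = 0"
      using dP by (simp add: inner_prod_def P_def)
    then have e: "a \<bullet> (fst (W t) - xs) - (g (W t) - g P) \<bullet> (snd (W t) - us) - (n - n') \<bullet> (snd (W t) - us) = 0"
      by (simp add: an(1) gP inner_diff_left inner_add_left)
    have "(a, - g (W t)) \<in> coupling A g (W t)" "(0, - g P) \<in> coupling A g P"
      using an(2) n'(3) by (auto simp: coupling_def)
    then have "((a, - g (W t)) - (0, - g P)) \<bullet> (W t - P) \<le> 0"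
      using maximal_dissipative_imp_dissipative[OF max] unfolding dissipative_def by blast
    then have c: "a \<bullet> (fst (W t) - xs) - (g (W t) - g P) \<bullet> (snd (W t) - us) \<le> 0"
      by (simp add: inner_prod_def P_def inner_diff_left inner_add_left)
    have "0 \<le> (n - n') \<bullet> (snd (W t) - us)" by (rule normal_cone_monotone[OF an(3) n'(2)])
    then have z: "a \<bullet> (fst (W t) - xs) - (g (W t) - g P) \<bullet> (snd (W t) - us) = 0" using e c by linarith
    have "((\<lambda>s. fst (W s)) has_vector_derivative fst d) (at t)"
      using bounded_linear.has_vector_derivative[OF bounded_linear_fst der] .
    from DERIV_imp_deriv[OF sq[OF this, of xs]]
    have "deriv (\<lambda>s. (norm (fst (W s) - xs))\<^sup>2) t = 2 * (a \<bullet> (fst (W t) - xs))" by (simp add: an(1))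
    then show ?thesis using z by (simp add: h_fun_def P_def inner_commute)
  qed
  then show ?thesis unfolding AE_lebesgue_iff_negligible using N(1) by blast
qed

text \<open>Along a bounded Lipschitz trajectory \<open>\<lambda> x - x'\<close> and the input stay bounded, so the compactness assumption applies at
almost every time; continuity extends this to all times.\<close>

lemma precompact_orbit:
  fixes A :: "'x::real_inner \<times> 'y::real_inner \<Rightarrow> 'x set"
  assumes comp: "compactness A" and V: "trajectory (closed_loop A g C K r) V"
    and lip: "\<And>s t. 0 \<le> s \<Longrightarrow> 0 \<le> t \<Longrightarrow> norm (V t - V s) \<le> L * \<bar>t - s\<bar>"
    and bd: "\<And>t. 0 \<le> t \<Longrightarrow> norm (V t) \<le> B"
  obtains S where "compact S" "\<And>t. 0 \<le> t \<Longrightarrow> V t \<in> S"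
proof -
  obtain l where fin: "\<exists>B::'y set. finite B \<and> span B = UNIV" and l: "l > 0"
    "\<And>F V. bounded F \<Longrightarrow> bounded V \<Longrightarrow> compact (closure {x. \<exists>f\<in>F. \<exists>u\<in>V. f \<in> {l *\<^sub>R x - a | a. a \<in> A (x, u)}})"
    using comp unfolding compactness_def by blast
  define Sx where "Sx = closure {x. \<exists>f\<in>cball 0 (l * B + L). \<exists>u\<in>cball 0 B. f \<in> {l *\<^sub>R x - a | a. a \<in> A (x, u)}}"
  have "compact Sx" unfolding Sx_def by (intro l(2)) auto
  have "compact (cball (0::'y) B)" using fin compact_cball_finite_span by blast
  then have S: "compact (Sx \<times> cball (0::'y) B)" using compact_Times[OF \<open>compact Sx\<close>] by blast
  obtain N where N: "negligible N"
    "\<And>t. 0 < t \<Longrightarrow> t \<notin> N \<Longrightarrow> \<exists>d\<in>closed_loop A g C K r (V t). (V has_vector_derivative d) (at t)"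
    using V unfolding trajectory_def by blast
  have ae: "V t \<in> Sx \<times> cball 0 B" if t: "0 < t" "t \<notin> N" for t
  proof -
    obtain d where d: "d \<in> closed_loop A g C K r (V t)" and der: "(V has_vector_derivative d) (at t)"
      using N(2)[OF t] by blast
    obtain a n where an: "d = (a, r - g (V t) - n)" "a \<in> A (V t)"
      using d by (rule closed_loopD)
    have "norm d \<le> L" using vector_derivative_lipschitz_bound[OF lip _ der] t by simp
    then have aL: "norm a \<le> L" using norm_fst_le[of a "snd d"] an(1) by simp
    have x: "norm (fst (V t)) \<le> B" and u: "norm (snd (V t)) \<le> B"
      using bd[of t] t norm_fst_le[of "fst (V t)" "snd (V t)"] norm_snd_le[of "snd (V t)" "fst (V t)"] by auto
    have "norm (l *\<^sub>R fst (V t) - a) \<le> l * B + L"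
    proof -
      have "norm (l *\<^sub>R fst (V t) - a) \<le> l * norm (fst (V t)) + norm a"
        using norm_triangle_ineq4[of "l *\<^sub>R fst (V t)" a] l(1) by simp
      also have "\<dots> \<le> l * B + L" using x aL l(1) by (intro add_mono mult_left_mono) auto
      finally show ?thesis .
    qed
    then have "fst (V t) \<in> Sx"
      unfolding Sx_def using u an(2)
      by (intro subsetD[OF closure_subset] CollectI bexI[of _ "l *\<^sub>R fst (V t) - a"] bexI[of _ "snd (V t)"]) auto
    then show ?thesis using u by (simp add: mem_Times_iff)
  qed
  have L0: "0 \<le> L" using order_trans[OF norm_ge_zero lip[of 0 1]] by simp
  have "V t \<in> Sx \<times> cball 0 B" if t: "0 \<le> t" for t
  proof -
    have "V t \<in> closure (Sx \<times> cball 0 B)"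
      unfolding closure_approachable
    proof (intro allI impI)
      fix e :: real assume e: "0 < e"
      have "t < t + e / (L + 1)" using e L0 by simp
      then obtain s where s: "t < s" "s < t + e / (L + 1)" "s \<notin> N" by (rule outside_negligible[OF N(1)])
      have "norm (V s - V t) \<le> L * (s - t)" using lip[of t s] s t by simp
      also have "\<dots> \<le> L * (e / (L + 1))" using s L0 by (intro mult_left_mono) auto
      also have "\<dots> < e" using e L0 by (simp add: field_simps)
      finally have "dist (V s) (V t) < e" by (simp add: dist_norm)
      then show "\<exists>y\<in>Sx \<times> cball 0 B. dist y (V t) < e" using ae[of s] s t by (intro bexI[of _ "V s"]) auto
    qed
    then show ?thesis using compact_imp_closed[OF S] by simp
  qed
  then show thesis using that S by blast
qed

text \<open>LaSalle's argument, applied twice. Detectability controls just the first component: it gives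
\<open>fst (W t) \<longlongrightarrow> xs\<close> for a limit solution \<open>W\<close>. On a limit solution \<open>U\<close> of \<open>W\<close> the first component is then
constant, so \<open>0 \<in> A (xs, snd (U t))\<close> and uniqueness of the input belonging to the steady state \<open>xs\<close>
forces \<open>U t = (xs, us)\<close>. As the distance to the equilibrium is the same along \<open>W\<close> and \<open>U\<close>, it is \<open>0\<close>.\<close>

lemma strong_solution_converges:
  fixes A :: "'x::{real_inner, complete_space} \<times> 'y::{real_inner, complete_space} \<Rightarrow> 'x set"
  assumes C: "C \<noteq> {}" "closed C" and K: "closed K" "interior K \<noteq> {}"
    and ss: "steady_state_behavior A C K"
    and mdc: "maximal_dissipative_coupling A g C"
    and comp: "compactness A"
    and P: "0 \<in> closed_loop A g C K r (xs, us)"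
    and det: "h_detectable A g C K r xs us"
    and v: "trajectory (closed_loop A g C K r) v"
  shows "(v \<longlongrightarrow> (xs, us)) at_top"
proof -
  define M where "M = closed_loop A g C K r"
  define P where "P = (xs, us)"
  have max: "maximal_dissipative (coupling A g)"
    using mdc by (auto simp: maximal_dissipative_coupling_def)
  have hc: "hull_closed M" unfolding M_def by (rule closed_loop_hull_closed[OF C K mdc])
  have dis: "dissipative M" unfolding M_def by (rule closed_loop_dissipative[OF max])
  have Ptraj: "trajectory M (\<lambda>_. P)"
    using P equilibrium_iff[of M P] strong_solution_trajectory unfolding M_def P_def equilibrium_def by blast
  note v = v[folded M_def]
  obtain t0 L where t0: "0 < t0" and lip: "\<And>s t. 0 \<le> s \<Longrightarrow> 0 \<le> t \<Longrightarrow> norm (v (t + t0) - v (s + t0)) \<le> L * \<bar>t - s\<bar>"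
    using trajectory_eventually_lipschitz[OF dis v] by blast
  define V where "V t = v (t + t0)" for t
  have V: "trajectory M V" unfolding V_def[abs_def] using trajectory_shift[OF v] t0 by simp
  have Vlip: "norm (V t - V s) \<le> L * \<bar>t - s\<bar>" if "0 \<le> s" "0 \<le> t" for s t
    unfolding V_def by (rule lip[OF that])
  have "norm (V t) \<le> norm (V 0 - P) + norm P" if "0 \<le> t" for t
    using dissipative_contraction[OF dis V Ptraj order_refl that] norm_triangle_ineq[of "V t - P" P] by simp
  then obtain S where S: "compact S" "\<And>t. 0 \<le> t \<Longrightarrow> V t \<in> S"
    using precompact_orbit[OF comp V[unfolded M_def] Vlip] by blast
  obtain r1 W where r1: "strict_mono r1" and W: "strong_solution M W"
    and limW: "\<And>t. 0 \<le> t \<Longrightarrow> (\<lambda>k. V (t + real (r1 k))) \<longlonglongrightarrow> W t"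
    and Wlip: "\<And>s t. 0 \<le> s \<Longrightarrow> 0 \<le> t \<Longrightarrow> norm (W t - W s) \<le> L * \<bar>t - s\<bar>"
    and WS: "\<And>t. 0 \<le> t \<Longrightarrow> W t \<in> S"
    using omega_limit_solution[OF hc dis V Vlip S] by blast
  note Wt = strong_solution_trajectory[OF W]
  have Wc: "norm (W t - P) = norm (W 0 - P)" if "0 \<le> t" for t
    by (rule omega_limit_distance_const[OF dis V Ptraj r1 limW that])
  have fstW: "((\<lambda>t. fst (W t)) \<longlongrightarrow> xs) at_top"
  proof -
    have "strong_solution (closed_loop A g C K r) (\<lambda>t. (fst (W t), snd (W t)))"
      using W by (simp add: M_def)
    moreover have "AE t in lebesgue. t > 0 \<longrightarrow> h_fun g (\<lambda>t. fst (W t)) (\<lambda>t. snd (W t)) (\<lambda>_. xs) (\<lambda>_. us) t = 0"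
      by (rule limit_solution_h_zero[OF max Wt[unfolded M_def] P Wc[unfolded P_def]])
    ultimately show ?thesis
      using det[unfolded h_detectable_def, rule_format, of "\<lambda>t. fst (W t)" "\<lambda>t. snd (W t)"] by blast
  qed
  obtain r2 U where r2: "strict_mono r2" and U: "strong_solution M U"
    and limU: "\<And>t. 0 \<le> t \<Longrightarrow> (\<lambda>k. W (t + real (r2 k))) \<longlonglongrightarrow> U t"
    by (rule omega_limit_solution[OF hc dis Wt Wlip S(1) WS]) metis+
  have fstU: "fst (U t) = xs" if t: "0 \<le> t" for t
  proof (rule LIMSEQ_unique)
    show "(\<lambda>k. fst (W (t + real (r2 k)))) \<longlonglongrightarrow> fst (U t)" by (intro tendsto_intros limU t)
    have "filterlim (\<lambda>k. real (r2 k)) at_top sequentially"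
      using filterlim_compose[OF filterlim_real_sequentially filterlim_subseq[OF r2]] .
    then have "filterlim (\<lambda>k. t + real (r2 k)) at_top sequentially"
      by (rule filterlim_tendsto_add_at_top[OF tendsto_const])
    then show "(\<lambda>k. fst (W (t + real (r2 k)))) \<longlonglongrightarrow> xs" by (rule filterlim_compose[OF fstW])
  qed
  obtain N where N: "negligible N" "\<And>t. 0 < t \<Longrightarrow> t \<notin> N \<Longrightarrow> \<exists>d\<in>M (U t). (U has_vector_derivative d) (at t)"
    using strong_solution_trajectory[OF U] unfolding trajectory_def by blast
  obtain t where t: "0 < t" "t \<notin> N" using outside_negligible[OF N(1), of 0 1] by auto
  then obtain d where d: "d \<in> M (U t)" and der: "(U has_vector_derivative d) (at t)" using N(2) by blast
  obtain a n where an: "d = (a, r - g (U t) - n)" "a \<in> A (U t)" "U t \<in> C \<times> K"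
    using d unfolding M_def by (rule closed_loopD)
  have "((\<lambda>s. fst (U s)) has_vector_derivative a) (at t)"
    using bounded_linear.has_vector_derivative[OF bounded_linear_fst der] by (simp add: an(1))
  moreover have "((\<lambda>s. fst (U s)) has_vector_derivative 0) (at t)"
    by (rule has_vector_derivative_transform_within_open[of "\<lambda>_. xs" 0 t "{0<..}"])
       (use t fstU in auto)
  ultimately have "a = 0" by (rule vector_derivative_unique_at)
  then have "0 \<in> A (xs, snd (U t))" "xs \<in> C" "snd (U t) \<in> K"
    using an(2,3) fstU[of t] t by (metis less_imp_le prod.collapse, metis less_imp_le mem_Times_iff, simp add: mem_Times_iff)
  moreover have "0 \<in> A (xs, us)" "us \<in> K"
    using P by (auto simp: closed_loop_def zero_prod_def split: if_splits)
  ultimately have "snd (U t) = us"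
    using conjunct2[OF ss[unfolded steady_state_behavior_def], rule_format, of xs "snd (U t)" us] by simp
  then have "U t = P" using fstU[of t] t by (simp add: P_def prod_eq_iff)
  then have "norm (U 0 - P) = 0"
    using omega_limit_distance_const[OF dis Wt Ptraj r2 limU, of t] t by simp
  moreover have "norm (U 0 - P) = norm (W 0 - P)"
  proof (rule LIMSEQ_unique)
    show "(\<lambda>k. norm (W (0 + real (r2 k)) - P)) \<longlonglongrightarrow> norm (U 0 - P)" by (intro tendsto_intros limU) simp
    have "norm (W (0 + real (r2 k)) - P) = norm (W 0 - P)" for k by (rule Wc) simp
    then show "(\<lambda>k. norm (W (0 + real (r2 k)) - P)) \<longlonglongrightarrow> norm (W 0 - P)"
      by (simp only: tendsto_const)
  qed
  ultimately have W0: "W 0 = P" by simp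
  show ?thesis unfolding P_def[symmetric]
  proof (rule tendstoI)
    fix e :: real assume "0 < e"
    then have "eventually (\<lambda>k. dist (V (0 + real (r1 k))) (W 0) < e) sequentially"
      using tendstoD[OF limW[of 0]] by simp
    then obtain k where k: "norm (V (real (r1 k)) - P) < e"
      by (auto simp: eventually_sequentially W0 dist_norm)
    have "dist (v s) P < e" if "s \<ge> real (r1 k) + t0" for s
    proof -
      have "norm (v s - P) \<le> norm (v (real (r1 k) + t0) - P)"
        using dissipative_contraction[OF dis v Ptraj _ that] t0 by simp
      then show ?thesis using k by (simp add: V_def dist_norm)
    qed
    then show "eventually (\<lambda>s. dist (v s) P < e) at_top"
      unfolding eventually_at_top_linorder by blast
  qed
qed

text \<open>The approximating strong solutions may depend on the time horizon. By contraction those that are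
chosen for the horizon \<open>0\<close> already approximate uniformly on the whole half-line.\<close>

lemma generalized_solution_uniform_limit:
  fixes w :: "real \<Rightarrow> 'h::real_inner"
  assumes M: "dissipative M" and w: "generalized_solution M w"
  obtains v where "\<And>n::nat. strong_solution M (v n)" "uniform_limit {0..} v w sequentially"
proof -
  obtain v where v: "\<And>n::nat. strong_solution M (v n)" and v0: "uniform_limit {0..0} v w sequentially"
    using w unfolding generalized_solution_def by blast
  have le: "norm (v n t - w t) \<le> norm (v n 0 - w 0)" if t: "0 \<le> t" for n t
  proof -
    obtain u where u: "\<And>n::nat. strong_solution M (u n)" and ul: "uniform_limit {0..t} u w sequentially"
      using w t unfolding generalized_solution_def by blast
    have lim: "(\<lambda>m. u m s) \<longlonglongrightarrow> w s" if "s \<in> {0..t}" for s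
      using tendsto_uniform_limitI[OF ul that] .
    show ?thesis
    proof (rule LIMSEQ_le)
      show "(\<lambda>m. norm (v n t - u m t)) \<longlonglongrightarrow> norm (v n t - w t)" using t by (intro tendsto_intros lim) auto
      show "(\<lambda>m. norm (v n 0 - u m 0)) \<longlonglongrightarrow> norm (v n 0 - w 0)" using t by (intro tendsto_intros lim) auto
      show "\<exists>N. \<forall>m\<ge>N. norm (v n t - u m t) \<le> norm (v n 0 - u m 0)"
        using dissipative_contraction[OF M strong_solution_trajectory[OF v] strong_solution_trajectory[OF u] order_refl t]
        by blast
    qed
  qed
  have "uniform_limit {0..} v w sequentially"
  proof (rule uniform_limitI)
    fix e :: real assume "0 < e"
    then have "eventually (\<lambda>n. dist (v n 0) (w 0) < e) sequentially"
      using tendstoD[OF tendsto_uniform_limitI[OF v0, of 0]] by simp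
    then show "\<forall>\<^sub>F n in sequentially. \<forall>t\<in>{0..}. dist (v n t) (w t) < e"
    proof eventually_elim
      case (elim n)
      show ?case
      proof
        fix t :: real assume "t \<in> {0..}"
        then show "dist (v n t) (w t) < e"
          using le[of t n] elim by (simp add: dist_norm)
      qed
    qed
  qed
  then show thesis using that v by blast
qed

theorem mainTheorem2:
  fixes A :: "'x::{real_inner, complete_space} \<times> 'y::{real_inner, complete_space} \<Rightarrow> 'x set"
    and g :: "'x \<times> 'y \<Rightarrow> 'y"
    and Dg :: "('x \<times> 'y) set"
    and C :: "'x set"
    and K :: "'y set"
  assumes "C \<noteq> {}" and "closed C" and "convex C"
    and "K \<noteq> {}" and "closed K" and "convex K" and "interior K \<noteq> {}"
    and "steady_state_behavior A C K"
    and "compatibility A Dg"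
    and "maximal_dissipative_coupling A g C"
    and "distinguishability A g C K"
    and "compactness A"
  shows
    "(\<forall>r xs us.
        (xs, us) \<in> mdom (closed_loop A g C K r) \<longrightarrow>
        equilibrium (closed_loop A g C K r) (xs, us) \<longrightarrow>
        h_detectable A g C K r xs us \<longrightarrow>
        (\<forall>x0\<in>C. \<forall>z0\<in>K. \<forall>x z.
           generalized_solution (closed_loop A g C K r) (\<lambda>t. (x t, z t)) \<longrightarrow>
           x 0 = x0 \<longrightarrow> z 0 = z0 \<longrightarrow>
           continuous_on {0..} (\<lambda>t. (x t, z t)) \<and>
           ((\<lambda>t. (x t, z t)) \<longlongrightarrow> (xs, us)) at_top))
     \<and>
     (\<forall>r. \<forall>x0\<in>C. \<forall>z0\<in>K. \<forall>x z.
        generalized_solution (closed_loop A g C K r) (\<lambda>t. (x t, z t)) \<longrightarrow>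
        x 0 = x0 \<longrightarrow> z 0 = z0 \<longrightarrow>
        (\<forall>t\<ge>0. z t \<in> K))"
proof -
  have max: "maximal_dissipative (coupling A g)"
    using assms(10) by (auto simp: maximal_dissipative_coupling_def)
  have dis: "dissipative (closed_loop A g C K r)" for r by (rule closed_loop_dissipative[OF max])
  have conv: "continuous_on {0..} w \<and> (w \<longlongrightarrow> (xs, us)) at_top"
    if eq: "equilibrium (closed_loop A g C K r) (xs, us)" and det: "h_detectable A g C K r xs us"
      and w: "generalized_solution (closed_loop A g C K r) w" for r xs us w
  proof
    obtain v where v: "\<And>n::nat. strong_solution (closed_loop A g C K r) (v n)"
      and lim: "uniform_limit {0..} v w sequentially"
      using generalized_solution_uniform_limit[OF dis w] by blast
    note traj = strong_solution_trajectory[OF v]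
    show "continuous_on {0..} w"
      by (rule uniform_limit_theorem[OF _ lim]) (simp_all add: trajectory_continuous_on[OF traj])
    have P: "0 \<in> closed_loop A g C K r (xs, us)" using eq by (simp add: equilibrium_iff)
    have vP: "(v n \<longlongrightarrow> (xs, us)) at_top" for n
      by (rule strong_solution_converges[OF assms(1,2,5,7,8,10,12) P det traj])
    show "(w \<longlongrightarrow> (xs, us)) at_top"
    proof (rule tendstoI)
      fix e :: real assume "0 < e"
      then have e2: "0 < e / 2" by simp
      obtain n where n: "\<And>t. 0 \<le> t \<Longrightarrow> dist (v n t) (w t) < e / 2"
        using uniform_limitD[OF lim e2] by (auto simp: eventually_sequentially)
      have "eventually (\<lambda>t. dist (v n t) (xs, us) < e / 2) at_top" by (rule tendstoD[OF vP e2])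
      then show "eventually (\<lambda>t. dist (w t) (xs, us) < e) at_top"
        using eventually_ge_at_top[of 0]
        by eventually_elim (metis n dist_triangle_half_r)
    qed
  qed
  have inK: "snd (w t) \<in> K"
    if w: "generalized_solution (closed_loop A g C K r) w" and t: "0 \<le> t" for r w t
  proof -
    obtain v where v: "\<And>n::nat. strong_solution (closed_loop A g C K r) (v n)"
      and lim: "uniform_limit {0..} v w sequentially"
      using generalized_solution_uniform_limit[OF dis w] by blast
    have "v n t \<in> mdom (closed_loop A g C K r)" for n
      using v[of n] t by (auto simp: strong_solution_def)
    then have "snd (v n t) \<in> K" for n by (auto simp: mdom_closed_loop split_beta)
    moreover have "(\<lambda>n. snd (v n t)) \<longlonglongrightarrow> snd (w t)"
      using t by (intro tendsto_snd tendsto_uniform_limitI[OF lim]) auto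
    ultimately show ?thesis by (rule closed_sequentially[OF assms(5)])
  qed
  show ?thesis using conv inK by fastforce
qed

end
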